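(* Let $K$ be a field. For any $f\in K\{x\}_\infty$ and $V,W\in\mathbf{PRT}'$ one has $$c_{V,W}(\Delta(f))=\sum_{T\in\mathbf{PRT}'}c_T(f)\cdot c_T(V\sqcup\!\sqcup W).$$
   Context: Trees and algebra. A finite planar rooted tree is a (nonempty) finite tree $T$ with a root $\rho_T$ and a linear (left-to-right) order on the set of children of each vertex. The arity of a vertex is the number of its children; $T$ is reduced if no vertex has arity $1$. $\mathbf{PRT}$ is the set of isomorphism classes of finite planar reduced rooted trees, $\mathbf{PRT}'=\{1\}\,\dot\cup\,\mathbf{PRT}$ with $1$ the empty tree, and $x\in\mathbf{PRT}$ is the tree with a single vertex. $L(T)$ is the set of leaves (vertices of arity $0$) of $T$. $\mathbf{A}=K\{x\}_\infty$ is the $K$-vector space with basis $\mathbf{PRT}'$, equipped for each $m\ge2$ with the $m$-ary product $\cdot_m:\mathbf{A}^m\to\mathbf{A}$, $\cdot_m(f_1,\dots,f_m)=f_1\cdots f_m$, the $K$-multilinear extension of $m$-ary grafting on $\mathbf{PRT}'$: for $T_1,\dots,T_m\in\mathbf{PRT}$ the grafting adds a new root whose children are, in order, the roots of $T_1,\dots,T_m$; entries equal to $1$ are deleted, i.e. if exactly $r$ of the entries are $\neq1$, the product is the $r$-ary grafting of these (in order) when $r\ge2$, the single remaining tree when $r=1$, and $1$ when $r=0$. Co-addition. $\mathbf{A}\otimes\mathbf{A}=\mathbf{A}\otimes_K\mathbf{A}$ carries for each $m\ge2$ the $K$-multilinear operation with $\cdot_m(f_1\otimes g_1,\dots,f_m\otimes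 g_m)=(f_1\cdots f_m)\otimes(g_1\cdots g_m)$. $\Delta:\mathbf{A}\to\mathbf{A}\otimes\mathbf{A}$ is the unique $K$-linear map with $\Delta(1)=1\otimes1$, compatible with all $\cdot_m$ ($m\ge2$), and with $\Delta(x)=x\otimes1+1\otimes x$. Coefficients. $c_T:\mathbf{A}\to K$ is the $K$-linear map with $c_T(S)=\delta_{ST}$ for $S\in\mathbf{PRT}'$; $c_{V,W}:\mathbf{A}\otimes\mathbf{A}\to K$ is the $K$-linear map with $c_{V,W}(S\otimes T)=1$ if $(V,W)=(S,T)$ and $0$ otherwise, for $S,T\in\mathbf{PRT}'$. Shuffle product. For vertices $a,b$ of a finite planar rooted tree $T$, $[a,b]_T$ denotes the simple path between them. $\mathrm{Red}(T)$ is the planar reduced rooted tree whose vertices are the vertices of $T$ of arity $\neq1$, whose edges are the pairs $\{a,b\}$ of distinct such vertices for which $[a,b]_T$ contains no vertex of arity $\ne1$ other than $a,b$, whose root is the vertex of arity $\neq1$ closest to $\rho_T$, and whose left-to-right orders are induced from $T$. For $I\subseteq L(T)$ let $T_I:=\bigcup_{a\in I}[a,\rho_T]_T$, a planar rooted tree with root $\rho_T$, and $T|I:=\mathrm{Red}(T_I)$, with $T|\emptyset=1$. For $V,W,T\in\mathbf{PRT}'$ let $N_{V,W}(T):=\{I\subseteq L(T):T|I=V,\ T|(L(T)-I)=W\}$ and $V\sqcup\!\sqcup W:=\sum_{T\in\mathbf{PRT}'}\sharp N_{V,W}(T)\cdot T\in K\{x\}_\infty$ (a finite sum), $\sharp$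 denoting cardinality. *)

theory Defs
  imports "HOL.Vector_Spaces" "HOL-Library.Poly_Mapping"
begin

section \<open>Planar rooted trees as graphs\<close>

text \<open>
  The relation \<open>left_of\<close> is meaningful only between children of a common vertex, where it is the
  strict left-to-right order.
\<close>

record 'v planar =
  verts :: "'v set"
  edges :: "'v set set"
  rt :: 'v
  left_of :: "('v \<times> 'v) set"

definition simple_path :: "'v planar \<Rightarrow> 'v \<Rightarrow> 'v \<Rightarrow> 'v list \<Rightarrow> bool" where
  "simple_path G a b p \<longleftrightarrow>
     p \<noteq> [] \<and> hd p = a \<and> last p = b \<and> distinct p \<and> set p \<subseteq> verts G \<and>
     successively (\<lambda>u v. {u, v} \<in> edges G) p"

text \<open>The vertex set of \<open>[a,b]\<close>; in a tree there is exactly one simple path from \<open>a\<close> to \<open>b\<close>.\<close>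

definition path_verts :: "'v planar \<Rightarrow> 'v \<Rightarrow> 'v \<Rightarrow> 'v set" where
  "path_verts G a b = {v. \<exists>p. simple_path G a b p \<and> v \<in> set p}"

definition children :: "'v planar \<Rightarrow> 'v \<Rightarrow> 'v set" where
  "children G v = {w. {v, w} \<in> edges G \<and> v \<noteq> w \<and> v \<in> path_verts G w (rt G)}"

definition arity :: "'v planar \<Rightarrow> 'v \<Rightarrow> nat" where
  "arity G v = card (children G v)"

definition leaves :: "'v planar \<Rightarrow> 'v set" where
  "leaves G = {v \<in> verts G. arity G v = 0}"

definition planar_iso :: "'v planar \<Rightarrow> 'w planar \<Rightarrow> bool" where
  "planar_iso G H \<longleftrightarrow> (\<exists>\<phi>. bij_betw \<phi> (verts G) (verts H) \<and> \<phi> (rt G) = rt H \<and>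
     (\<forall>a\<in>verts G. \<forall>b\<in>verts G. {a, b} \<in> edges G \<longleftrightarrow> {\<phi> a, \<phi> b} \<in> edges H) \<and>
     (\<forall>v\<in>verts G. \<forall>a\<in>children G v. \<forall>b\<in>children G v.
        (a, b) \<in> left_of G \<longleftrightarrow> (\<phi> a, \<phi> b) \<in> left_of H))"

text \<open>
  The subtree \<open>T\<^sub>I\<close>, the union of the paths \<open>[a, root]\<close> for \<open>a \<in> I\<close>. A simple path in a tree has no
  chords, so its edges are exactly the edges of the tree with both ends on it.
\<close>

definition root_span :: "'v planar \<Rightarrow> 'v set \<Rightarrow> 'v planar" where
  "root_span G I = (let V = (\<Union>a\<in>I. path_verts G a (rt G)) in
     \<lparr>verts = V,
      edges = {e \<in> edges G. \<exists>a\<in>I. e \<subseteq> path_verts G a (rt G)},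
      rt = rt G,
      left_of = left_of G \<inter> V \<times> V\<rparr>)"

text \<open>
  In the induced order, \<open>b\<close> is left of \<open>b'\<close> if they lie below (or are equal to) children \<open>c\<close>, \<open>c'\<close>
  of a common vertex of \<open>G\<close> with \<open>c\<close> left of \<open>c'\<close>.
\<close>

definition Red :: "'v planar \<Rightarrow> 'v planar" where
  "Red G = (let B = {v \<in> verts G. arity G v \<noteq> 1} in
     \<lparr>verts = B,
      edges = {{a, b} |a b. a \<in> B \<and> b \<in> B \<and> a \<noteq> b \<and> path_verts G a b \<inter> B \<subseteq> {a, b}},
      rt = (ARG_MIN (\<lambda>v. card (path_verts G v (rt G))) v. v \<in> B),
      left_of = {(b, b'). b \<in> B \<and> b' \<in> B \<and>
        (\<exists>v\<in>verts G. \<exists>c\<in>children G v. \<exists>c'\<in>children G v.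
           (c, c') \<in> left_of G \<and> c \<in> path_verts G b (rt G) \<and> c' \<in> path_verts G b' (rt G))}\<rparr>)"


section \<open>Isomorphism classes of planar rooted trees\<close>

text \<open>
  Every finite planar rooted tree is isomorphic to exactly one \<open>tree_graph t\<close>. Its vertices are the
  positions in \<open>t\<close>: \<open>[]\<close> is the root and \<open>p @ [i]\<close> is the child number \<open>i\<close> of \<open>p\<close>.
\<close>

datatype ptree = Node "ptree list"

function positions :: "ptree \<Rightarrow> nat list set" where
  "positions (Node ts) = insert [] (\<Union>i\<in>{..<length ts}. (#) i ` positions (ts ! i))"
  by pat_completeness auto
termination
  by (relation "measure size") (auto simp: less_Suc_eq_le intro!: size_list_estimation'[OF nth_mem])

definition tree_graph :: "ptree \<Rightarrow> nat list planar" where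
  "tree_graph t =
     \<lparr>verts = positions t,
      edges = {{p, p @ [i]} |p i. p @ [i] \<in> positions t},
      rt = [],
      left_of = {(p @ [i], p @ [j]) |p i j. i < j \<and> p @ [i] \<in> positions t \<and> p @ [j] \<in> positions t}\<rparr>"

fun reduced :: "ptree \<Rightarrow> bool" where
  "reduced (Node ts) \<longleftrightarrow> length ts \<noteq> 1 \<and> (\<forall>t\<in>set ts. reduced t)"

typedef prt = "{t. reduced t}"
  by (rule exI[of _ "Node []"]) simp

text \<open>\<open>PRT'\<close>, where \<open>None\<close> is the empty tree \<open>1\<close>.\<close>

type_synonym prt' = "prt option"

definition leaf :: prt where
  "leaf = Abs_prt (Node [])"

definition leaves' :: "prt' \<Rightarrow> nat list set" where
  "leaves' T = (case T of None \<Rightarrow> {} | Some t \<Rightarrow> leaves (tree_graph (Rep_prt t)))"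

definition iso_class :: "'v planar \<Rightarrow> prt" where
  "iso_class G = (THE t. planar_iso (tree_graph (Rep_prt t)) G)"

text \<open>\<open>T|I\<close>\<close>

definition restr :: "prt' \<Rightarrow> nat list set \<Rightarrow> prt'" where
  "restr T I = (case T of
      None \<Rightarrow> None
    | Some t \<Rightarrow> if I = {} then None
        else Some (iso_class (Red (root_span (tree_graph (Rep_prt t)) I))))"

fun graft :: "prt list \<Rightarrow> prt" where
  "graft ts = Abs_prt (Node (map Rep_prt ts))"

text \<open>Grafting on \<open>PRT'\<close>: entries equal to the empty tree are deleted.\<close>

definition graft' :: "prt' list \<Rightarrow> prt'" where
  "graft' Ts = (case [t. Some t \<leftarrow> Ts] of
      [] \<Rightarrow> None
    | [t] \<Rightarrow> Some t
    | ts \<Rightarrow> Some (graft ts))"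


section \<open>The algebra and its tensor square\<close>

text \<open>
  Vector spaces with a given basis \<open>'b\<close> are finitely supported functions \<open>'b \<Rightarrow>\<^sub>0 'k\<close>. In particular
  the tensor square of the space with basis \<open>PRT'\<close> is the space with basis \<open>PRT' \<times> PRT'\<close>, where
  the basis element \<open>(S, T)\<close> is \<open>S \<otimes> T\<close>.
\<close>

type_synonym 'k alg = "prt' \<Rightarrow>\<^sub>0 'k"
type_synonym 'k alg2 = "(prt' \<times> prt') \<Rightarrow>\<^sub>0 'k"

definition scale :: "'k::field \<Rightarrow> ('b \<Rightarrow>\<^sub>0 'k) \<Rightarrow> ('b \<Rightarrow>\<^sub>0 'k)" where
  "scale c f = Poly_Mapping.map ((*) c) f"

definition basis :: "'b \<Rightarrow> ('b \<Rightarrow>\<^sub>0 'k::field)" where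
  "basis b = Poly_Mapping.single b 1"

text \<open>The \<open>K\<close>-multilinear extension, of arity \<open>length fs\<close>, of a map \<open>G\<close> on tuples of basis elements.\<close>

definition multilin ::
    "('b list \<Rightarrow> ('c \<Rightarrow>\<^sub>0 'k)) \<Rightarrow> ('b \<Rightarrow>\<^sub>0 'k::field) list \<Rightarrow> ('c \<Rightarrow>\<^sub>0 'k)" where
  "multilin G fs = (\<Sum>bs\<in>listset (map Poly_Mapping.keys fs).
     scale (prod_list (map2 Poly_Mapping.lookup fs bs)) (G bs))"

definition tensor :: "('b \<Rightarrow>\<^sub>0 'k) \<Rightarrow> ('c \<Rightarrow>\<^sub>0 'k::field) \<Rightarrow> ('b \<times> 'c \<Rightarrow>\<^sub>0 'k)" where
  "tensor f g = (\<Sum>b\<in>Poly_Mapping.keys f. \<Sum>c\<in>Poly_Mapping.keys g.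
     Poly_Mapping.single (b, c) (Poly_Mapping.lookup f b * Poly_Mapping.lookup g c))"

definition alg_prod :: "'k::field alg list \<Rightarrow> 'k alg" where
  "alg_prod = multilin (\<lambda>Ts. basis (graft' Ts))"

definition alg2_prod :: "'k::field alg2 list \<Rightarrow> 'k alg2" where
  "alg2_prod = multilin (\<lambda>ps. tensor (basis (graft' (map fst ps))) (basis (graft' (map snd ps))))"

definition is_coaddition :: "('k::field alg \<Rightarrow> 'k alg2) \<Rightarrow> bool" where
  "is_coaddition D \<longleftrightarrow>
     Vector_Spaces.linear scale scale D \<and>
     D (basis None) = tensor (basis None) (basis None) \<and>
     (\<forall>fs. 2 \<le> length fs \<longrightarrow> D (alg_prod fs) = alg2_prod (map D fs)) \<and>
     D (basis (Some leaf)) =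
       tensor (basis (Some leaf)) (basis None) + tensor (basis None) (basis (Some leaf))"

definition Delta :: "'k::field alg \<Rightarrow> 'k alg2" where
  "Delta = (THE D. is_coaddition D)"

definition coeff :: "prt' \<Rightarrow> 'k::field alg \<Rightarrow> 'k" where
  "coeff T f = Poly_Mapping.lookup f T"

definition coeff2 :: "prt' \<Rightarrow> prt' \<Rightarrow> 'k::field alg2 \<Rightarrow> 'k" where
  "coeff2 V W h = Poly_Mapping.lookup h (V, W)"


section \<open>The shuffle product\<close>

definition splits :: "prt' \<Rightarrow> prt' \<Rightarrow> prt' \<Rightarrow> nat list set set" where
  "splits V W T = {I. I \<subseteq> leaves' T \<and> restr T I = V \<and> restr T (leaves' T - I) = W}"

text \<open>\<open>Sum_any\<close> sums over the whole type; only finitely many summands are nonzero.\<close>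

definition shuffle :: "prt' \<Rightarrow> prt' \<Rightarrow> 'k::field alg" where
  "shuffle V W = Sum_any (\<lambda>T. scale (of_nat (card (splits V W T))) (basis T))"


section \<open>Existence and uniqueness of the co-addition\<close>

lemma lookup_scale [simp]: "Poly_Mapping.lookup (scale c f) b = c * Poly_Mapping.lookup f b"
  by (simp add: scale_def Poly_Mapping.map.rep_eq when_def)

lemma vector_space_scale: "vector_space (scale :: 'k::field \<Rightarrow> ('b \<Rightarrow>\<^sub>0 'k) \<Rightarrow> _)"
  by unfold_locales (auto intro!: poly_mapping_eqI simp: lookup_add algebra_simps)

definition linext :: "('b \<Rightarrow> ('c \<Rightarrow>\<^sub>0 'k)) \<Rightarrow> ('b \<Rightarrow>\<^sub>0 'k::field) \<Rightarrow> ('c \<Rightarrow>\<^sub>0 'k)" where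
  "linext G f = (\<Sum>b\<in>Poly_Mapping.keys f. scale (Poly_Mapping.lookup f b) (G b))"

lemma scale_add: "scale c (f + g) = scale c f + scale c g"
  and scale_add_left: "scale (a + b) f = scale a f + scale b f"
  and scale_scale: "scale a (scale b f) = scale (a * b) f"
  and scale_0 [simp]: "scale 0 f = 0" "scale c 0 = 0"
  and scale_1 [simp]: "scale 1 f = f"
  by (auto intro!: poly_mapping_eqI simp: lookup_add algebra_simps)

lemma scale_sum: "scale c (sum h A) = (\<Sum>a\<in>A. scale c (h a))"
  by (induction A rule: infinite_finite_induct) (auto simp: scale_add)

lemma linext_superset:
  assumes "finite A" "Poly_Mapping.keys f \<subseteq> A"
  shows "linext G f = (\<Sum>b\<in>A. scale (Poly_Mapping.lookup f b) (G b))"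
  unfolding linext_def by (rule sum.mono_neutral_left) (use assms in \<open>auto simp: in_keys_iff\<close>)

lemma linext_add: "linext G (f + g) = linext G f + linext G g"
proof -
  let ?A = "Poly_Mapping.keys f \<union> Poly_Mapping.keys g"
  have "Poly_Mapping.keys (f + g) \<subseteq> ?A" by (rule Poly_Mapping.keys_add)
  then show ?thesis
    by (simp add: linext_superset[of ?A] lookup_add scale_add_left sum.distrib)
qed

lemma linext_scale: "linext G (scale c f) = scale c (linext G f)"
proof -
  have "Poly_Mapping.keys (scale c f) \<subseteq> Poly_Mapping.keys f" by (auto simp: in_keys_iff)
  then show ?thesis
    by (simp add: linext_superset[of "Poly_Mapping.keys f"] scale_sum scale_scale)
qed

lemma linext_0 [simp]: "linext G 0 = 0"
  by (simp add: linext_def)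

lemma linext_sum: "linext G (sum h A) = (\<Sum>a\<in>A. linext G (h a))"
  by (induction A rule: infinite_finite_induct) (auto simp: linext_add)

lemma linext_basis [simp]: "linext G (basis b) = G b"
  by (simp add: linext_def basis_def)

lemma linext_linext: "linext G (linext H f) = linext (\<lambda>b. linext G (H b)) f"
  by (simp add: linext_def[of H] linext_def[of "\<lambda>b. linext G (H b)"] linext_sum linext_scale)

lemma linext_id: "linext basis f = f"
proof (rule poly_mapping_eqI)
  fix k
  show "Poly_Mapping.lookup (linext basis f) k = Poly_Mapping.lookup f k"
    by (cases "k \<in> Poly_Mapping.keys f")
      (auto simp: linext_def lookup_sum basis_def lookup_single when_def in_keys_iff
        if_distrib[of "\<lambda>x. _ * x"] cong: if_cong)
qed

lemma linear_linext: "Vector_Spaces.linear scale scale (linext G)"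
  by (simp add: Vector_Spaces.linear_iff vector_space_scale linext_add linext_scale)

lemma linear_eq_linext:
  assumes "Vector_Spaces.linear scale scale D"
  shows "D f = linext (\<lambda>b. D (basis b)) f"
proof -
  interpret Vector_Spaces.linear scale scale D by fact
  have "D f = D (linext basis f)" by (simp add: linext_id)
  also have "\<dots> = linext (\<lambda>b. D (basis b)) f"
    unfolding linext_def by (simp add: sum scale)
  finally show ?thesis .
qed

lemma linext_plus_fun: "linext (\<lambda>b. G b + H b) f = linext G f + linext H f"
  by (simp add: linext_def scale_add sum.distrib)

lemma multilin_Nil [simp]: "multilin G [] = G []"
  by (simp add: multilin_def)

lemma multilin_Cons: "multilin G (f # fs) = linext (\<lambda>b. multilin (\<lambda>bs. G (b # bs)) fs) f"
proof -
  let ?A = "Poly_Mapping.keys f" and ?L = "listset (map Poly_Mapping.keys fs)"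
  have "set_Cons ?A ?L = (\<lambda>(b, bs). b # bs) ` (?A \<times> ?L)"
    by (auto simp: set_Cons_def)
  moreover have "inj_on (\<lambda>(b, bs). b # bs) (?A \<times> ?L)"
    by (auto simp: inj_on_def)
  ultimately have "multilin G (f # fs) = (\<Sum>(b, bs)\<in>?A \<times> ?L.
      scale (Poly_Mapping.lookup f b * prod_list (map2 Poly_Mapping.lookup fs bs)) (G (b # bs)))"
    by (simp add: multilin_def sum.reindex) (simp add: case_prod_beta)
  also have "\<dots> = linext (\<lambda>b. multilin (\<lambda>bs. G (b # bs)) fs) f"
    by (simp add: linext_def multilin_def sum.cartesian_product[symmetric] scale_sum scale_scale)
  finally show ?thesis .
qed

lemma linext_multilin: "linext G (multilin H fs) = multilin (\<lambda>bs. linext G (H bs)) fs"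
  by (induction fs arbitrary: H) (simp_all add: multilin_Cons linext_linext)

lemma linext_scale_fun: "linext (\<lambda>b. scale c (G b)) f = scale c (linext G f)"
  by (simp add: linext_def scale_sum scale_scale mult.commute)

lemma linext_0_fun [simp]: "linext (\<lambda>b. 0) f = 0"
  by (simp add: linext_def)

lemma linext_sum_fun: "linext (\<lambda>b. \<Sum>a\<in>A. H a b) f = (\<Sum>a\<in>A. linext (H a) f)"
  by (induction A rule: infinite_finite_induct) (simp_all add: linext_plus_fun)

lemma linext_swap:
  "linext (\<lambda>a. linext (\<lambda>b. G a b) g) f = linext (\<lambda>b. linext (\<lambda>a. G a b) f) g"
  by (simp add: linext_def[of _ g] linext_sum_fun linext_scale_fun)

lemma multilin_linext_swap:
  "multilin (\<lambda>bs. linext (\<lambda>a. H a bs) f) fs = linext (\<lambda>a. multilin (H a) fs) f"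
  by (induction fs arbitrary: H) (simp_all add: multilin_Cons linext_swap[of _ _ f])

lemma multilin_map_linext:
  "multilin G (map (linext d) fs) = multilin (\<lambda>bs. multilin G (map d bs)) fs"
  by (induction fs arbitrary: G)
    (simp_all add: multilin_Cons linext_linext multilin_linext_swap)

lemma multilin_map_basis: "multilin G (map basis bs) = G bs"
  by (induction bs arbitrary: G) (simp_all add: multilin_Cons)

lemma scale_basis: "scale c (basis b) = Poly_Mapping.single b c"
  by (auto intro!: poly_mapping_eqI simp: basis_def lookup_single when_def)

lemma tensor_eq_linext: "tensor f g = linext (\<lambda>b. linext (\<lambda>c. basis (b, c)) g) f"
  by (simp add: tensor_def linext_def scale_sum scale_basis[symmetric] scale_scale)

lemma tensor_basis: "tensor (basis b) (basis c) = basis (b, c)"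
  by (simp add: tensor_eq_linext)

lemma tensor_linext: "tensor (linext G f) (linext H g) = linext (\<lambda>b. linext (\<lambda>c. tensor (G b) (H c)) g) f"
  by (simp add: tensor_eq_linext linext_linext linext_swap[of _ g])

text \<open>The product on the tensor square is the factorwise product.\<close>

lemma alg2_prod_tensor:
  assumes "length fs = length gs"
  shows "alg2_prod (map2 tensor fs gs) = tensor (alg_prod fs) (alg_prod gs)"
proof -
  have "multilin (\<lambda>ps. tensor (G (map fst ps)) (H (map snd ps))) (map2 tensor fs gs) =
      tensor (multilin G fs) (multilin H gs)"
    for G H :: "prt' list \<Rightarrow> 'a alg"
    using assms
  proof (induction fs gs arbitrary: G H rule: list_induct2)
    case (Cons f fs g gs)
    have "multilin (\<lambda>ps. tensor (G (b # map fst ps)) (H (c # map snd ps))) (map2 tensor fs gs) =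
        tensor (multilin (\<lambda>bs. G (b # bs)) fs) (multilin (\<lambda>bs. H (c # bs)) gs)" for b c
      by (rule Cons.IH)
    then show ?case
      by (simp add: multilin_Cons tensor_eq_linext[of f g] linext_linext tensor_linext)
  qed simp
  then show ?thesis by (simp add: alg_prod_def alg2_prod_def)
qed

fun coadd_tree :: "ptree \<Rightarrow> 'k::field alg2" where
  "coadd_tree (Node ts) = (if ts = []
     then tensor (basis (Some leaf)) (basis None) + tensor (basis None) (basis (Some leaf))
     else alg2_prod (map coadd_tree ts))"

definition coadd_basis :: "prt' \<Rightarrow> 'k::field alg2" where
  "coadd_basis T = (case T of None \<Rightarrow> basis (None, None) | Some t \<Rightarrow> coadd_tree (Rep_prt t))"

lemma graft'_append_None: "graft' (xs @ None # ys) = graft' (xs @ ys)"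
  by (simp add: graft'_def)

lemma multilin_drop_unit:
  assumes "\<And>xs ys. G (xs @ (None, None) # ys) = G (xs @ ys)"
  shows "multilin G (map coadd_basis Ts) = multilin G (map (\<lambda>t. coadd_basis (Some t)) [t. Some t \<leftarrow> Ts])"
  using assms
proof (induction Ts arbitrary: G)
  case (Cons T Ts)
  show ?case
  proof (cases T)
    case None
    have "(\<lambda>bs. G ((None, None) # bs)) = G" using Cons.prems[of "[]"] by simp
    with None show ?thesis
      using Cons.IH[of G] Cons.prems by (simp add: multilin_Cons coadd_basis_def)
  next
    case (Some t)
    have "multilin (\<lambda>bs. G (b # bs)) (map coadd_basis Ts) =
        multilin (\<lambda>bs. G (b # bs)) (map (\<lambda>t. coadd_basis (Some t)) [t. Some t \<leftarrow> Ts])" for b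
      by (rule Cons.IH) (use Cons.prems[of "b # _"] in simp)
    with Some show ?thesis by (simp add: multilin_Cons)
  qed
qed simp

lemma Rep_graft: "length ts \<noteq> 1 \<Longrightarrow> Rep_prt (graft ts) = Node (map Rep_prt ts)"
  using Rep_prt by (auto intro!: Abs_prt_inverse)

lemma graft'_singleton: "graft' [T] = T"
  by (cases T) (simp_all add: graft'_def)

lemma alg2_prod_singleton: "alg2_prod [f] = f"
  by (simp add: alg2_prod_def multilin_Cons graft'_singleton tensor_basis linext_id)

lemma coadd_basis_graft': "coadd_basis (graft' Ts) = alg2_prod (map coadd_basis Ts)"
proof -
  define ts where "ts = [t. Some t \<leftarrow> Ts]"
  have "alg2_prod (map coadd_basis Ts) = alg2_prod (map (\<lambda>t. coadd_basis (Some t)) ts)"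
    unfolding alg2_prod_def ts_def
    by (rule multilin_drop_unit) (simp add: graft'_append_None)
  also have "\<dots> = coadd_basis (graft' Ts)"
  proof -
    consider "ts = []" | t where "ts = [t]" | t u us where "ts = t # u # us"
      by (metis list.exhaust)
    then show ?thesis
    proof cases
      case 1
      then show ?thesis
        by (simp add: graft'_def ts_def[symmetric] alg2_prod_def coadd_basis_def tensor_basis)
    next
      case 2
      then show ?thesis
        by (simp add: graft'_def ts_def[symmetric] alg2_prod_singleton)
    next
      case 3
      then have "graft' Ts = Some (graft ts)" and "length ts \<noteq> 1"
        by (simp_all add: graft'_def ts_def[symmetric])
      then show ?thesis
        using 3 by (simp add: coadd_basis_def Rep_graft comp_def del: graft.simps)
    qed
  qed
  finally show ?thesis ..
qed

lemma Rep_leaf: "Rep_prt leaf = Node []"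
  by (simp add: leaf_def Abs_prt_inverse)

lemma coadd_basis_None: "coadd_basis None = tensor (basis None) (basis None)"
  by (simp add: coadd_basis_def tensor_basis)

lemma coadd_basis_leaf: "coadd_basis (Some leaf) =
    tensor (basis (Some leaf)) (basis None) + tensor (basis None) (basis (Some leaf))"
  by (simp add: coadd_basis_def Rep_leaf)

lemma linext_coadd_basis_prod:
  "linext coadd_basis (alg_prod fs) = alg2_prod (map (linext coadd_basis) fs)"
  by (simp add: alg_prod_def linext_multilin coadd_basis_graft' alg2_prod_def multilin_map_linext)

lemma is_coaddition_linext: "is_coaddition (linext coadd_basis)"
  by (simp add: is_coaddition_def linear_linext coadd_basis_None coadd_basis_leaf
      linext_coadd_basis_prod)

lemma is_coaddition_unique:
  assumes D: "is_coaddition D"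
  shows "D = linext coadd_basis"
proof -
  have tree: "D (basis (Some (Abs_prt t))) = coadd_tree t" if "reduced t" for t
    using that
  proof (induction t)
    case (Node ts)
    show ?case
    proof (cases "ts = []")
      case True
      then show ?thesis using D by (simp add: is_coaddition_def leaf_def)
    next
      case False
      let ?Ts = "map (Some \<circ> Abs_prt) ts"
      have len: "2 \<le> length ts" using Node.prems False
        by (cases ts rule: list.exhaust) (auto simp: Suc_le_eq)
      have "map Rep_prt (map Abs_prt ts) = ts"
        using Node.prems by (auto simp: Abs_prt_inverse intro!: map_idI)
      then have "graft' ?Ts = Some (Abs_prt (Node ts))"
        using len by (cases ts; cases "tl ts") (auto simp: graft'_def comp_def)
      then have "alg_prod (map basis ?Ts) = basis (Some (Abs_prt (Node ts)))"
        by (simp add: alg_prod_def multilin_map_basis del: map_map)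
      then have "D (basis (Some (Abs_prt (Node ts)))) = alg2_prod (map D (map basis ?Ts))"
        using D len by (metis is_coaddition_def length_map)
      also have "map D (map basis ?Ts) = map coadd_tree ts"
        using Node by auto
      finally show ?thesis using False by simp
    qed
  qed
  have "D (basis T) = coadd_basis T" for T
  proof (cases T)
    case None
    then show ?thesis using D by (simp add: is_coaddition_def coadd_basis_def tensor_basis)
  next
    case (Some t)
    then show ?thesis
      using tree[of "Rep_prt t"] Rep_prt[of t] by (simp add: coadd_basis_def Rep_prt_inverse)
  qed
  then show ?thesis
    using linear_eq_linext[of D] D by (auto simp: is_coaddition_def)
qed

theorem is_coaddition_Delta: "is_coaddition Delta"
  unfolding Delta_def
  by (rule theI[of _ "linext coadd_basis"]) (auto intro: is_coaddition_linext is_coaddition_unique)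

end

theory Submission
  imports Defs "HOL-Library.Sublist"
begin

text \<open>
  Comparing coefficients, it suffices to show that
  \<open>\<Delta>(T) = \<Sum>\<^sub>I T|I \<otimes> T|(L(T) - I)\<close> for every basis tree \<open>T\<close>. For a tree that is a grafting of
  \<open>T\<^sub>1, \<dots>, T\<^sub>m\<close>, a set \<open>I\<close> of leaves is a tuple of sets \<open>I\<^sub>j\<close> of leaves of \<open>T\<^sub>j\<close>, and \<open>T|I\<close> is the grafting
  of the \<open>T\<^sub>j|I\<^sub>j\<close> with empty trees deleted; so the formula follows by induction from the
  compatibility of \<open>\<Delta>\<close> with the products. The recursion for \<open>T|I\<close> holds because the graph
  \<open>Red(T\<^sub>I)\<close> is determined by the prefix order and the left-to-right order on the branching
  positions of \<open>T\<^sub>I\<close>, and because the root of \<open>T\<^sub>I\<close> disappears exactly if a single \<open>I\<^sub>j\<close> is nonempty.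
\<close>

section \<open>Paths and reductions of position graphs\<close>

text \<open>
  Both the graph of a tree and the subtree \<open>T\<^sub>I\<close> of it are of this form; in the latter, child numbers
  may be skipped.
\<close>

definition position_graph :: "nat list set \<Rightarrow> nat list planar" where
  "position_graph P =
     \<lparr>verts = P,
      edges = {{p, p @ [i]} |p i. p @ [i] \<in> P},
      rt = [],
      left_of = {(p @ [i], p @ [j]) |p i j. i < j \<and> p @ [i] \<in> P \<and> p @ [j] \<in> P}\<rparr>"

definition prefix_closed :: "'a list set \<Rightarrow> bool" where
  "prefix_closed P \<longleftrightarrow> (\<forall>q\<in>P. \<forall>p. prefix p q \<longrightarrow> p \<in> P)"

text \<open>The order relation that \<^const>\<open>Red\<close> induces, here on all pairs of incomparable positions.\<close>

definition strictly_left :: "nat list \<Rightarrow> nat list \<Rightarrow> bool" where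
  "strictly_left p q \<longleftrightarrow> (\<exists>v i j. i < j \<and> prefix (v @ [i]) p \<and> prefix (v @ [j]) q)"

lemma tree_graph_eq: "tree_graph t = position_graph (positions t)"
  by (simp add: tree_graph_def position_graph_def)

lemma position_graph_simps [simp]:
  "verts (position_graph P) = P" "rt (position_graph P) = []"
  by (simp_all add: position_graph_def)

lemma edges_position_graph_iff:
  "{u, v} \<in> edges (position_graph P) \<longleftrightarrow>
    (\<exists>i. v = u @ [i] \<and> v \<in> P) \<or> (\<exists>i. u = v @ [i] \<and> u \<in> P)"
  by (auto simp: position_graph_def doubleton_eq_iff)

section \<open>Uniqueness of simple paths between positions\<close>

text \<open>A discrete intermediate value argument: it locates the step at which a path leaves a set
  and, applied to the complement, the step at which it returns.\<close>

lemma successively_crossing: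
  assumes "successively R xs" "xs \<noteq> []" "hd xs \<in> S" "last xs \<notin> S"
  obtains us x y vs where "xs = us @ x # y # vs" "R x y" "x \<in> S" "y \<notin> S"
  using assms
proof (induction xs arbitrary: thesis)
  case (Cons a xs)
  show ?case
  proof (cases "xs = []")
    case True
    then show ?thesis using Cons.prems by simp
  next
    case False
    show ?thesis
    proof (cases "hd xs \<in> S")
      case True
      from Cons.prems False obtain us x y vs where "xs = us @ x # y # vs" "R x y" "x \<in> S" "y \<notin> S"
        using Cons.IH[OF _ _ _ True] by (metis last_ConsR successively_Cons)
      then show ?thesis using Cons.prems(1)[of "a # us"] by simp
    next
      case hd: False
      obtain y ys where "xs = y # ys" using False by (cases xs) auto
      then show ?thesis using Cons.prems(1)[of "[]" a y ys] Cons.prems hd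
        by simp
    qed
  qed
qed simp

text \<open>A path leaving and re-entering \<open>S\<close> would pass through \<open>w\<close>, the only vertex of \<open>S\<close> on its boundary, twice.\<close>

lemma distinct_path_stays:
  assumes path: "successively R p" "distinct p" "p \<noteq> []" "hd p \<in> S" "last p \<in> S"
    and exit: "\<And>x y. R x y \<Longrightarrow> x \<in> S \<Longrightarrow> y \<notin> S \<Longrightarrow> x = w"
    and enter: "\<And>x y. R x y \<Longrightarrow> x \<notin> S \<Longrightarrow> y \<in> S \<Longrightarrow> y = w"
  shows "set p \<subseteq> S"
proof (rule ccontr)
  assume "\<not> set p \<subseteq> S"
  then obtain z where z: "z \<in> set p" "z \<notin> S" by blast
  then obtain xs ys where p: "p = xs @ z # ys" by (meson split_list)
  have xs: "xs \<noteq> []" and ys: "ys \<noteq> []" using path z p by auto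
  have 1: "successively R (xs @ [z])" "successively R (z # ys)"
    using path(1) unfolding p by (auto simp: successively_append_iff successively_Cons)
  have "hd (xs @ [z]) \<in> S" using path(4) p xs by simp
  with 1(1) z obtain us x y vs where a: "xs @ [z] = us @ x # y # vs" "R x y" "x \<in> S" "y \<notin> S"
    using successively_crossing[of R "xs @ [z]" S]
    by (metis (no_types) append_is_Nil_conv last_snoc not_Cons_self2)
  \<comment> \<open>\<open>x\<close> comes before \<open>z\<close>, while \<open>y\<close> below
    comes after it. Both are \<open>w\<close>, so \<open>w\<close> would occur twice in
    \<open>p\<close>.\<close>
  have "x \<in> set xs" using a(1) by (metis append_butlast_last_id butlast_append butlast_snoc
        in_set_conv_decomp list.distinct(1) append.assoc append_Cons butlast.simps(2))
  moreover have "x = w" using exit a by blast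
  moreover have "last (z # ys) \<notin> - S" using path(5) p by simp
  with 1(2) z obtain us x y vs where b: "z # ys = us @ x # y # vs" "R x y" "x \<notin> S" "y \<in> S"
    using successively_crossing[of R "z # ys" "- S"]
    by (metis ComplD ComplI list.distinct(1) list.sel(1))
  have "y \<in> set ys" using b(1) by (cases us) auto
  moreover have "y = w" using enter b by blast
  ultimately show False using path(2) p by auto
qed

lemma simple_path_rev:
  assumes "simple_path G a b p"
  shows "simple_path G b a (rev p)"
  using assms by (auto simp: simple_path_def hd_rev last_rev insert_commute)

lemma path_verts_commute: "path_verts G a b = path_verts G b a"
  unfolding path_verts_def using simple_path_rev by (metis (no_types, lifting) set_rev)

text \<open>Going from \<open>a\<close> towards \<open>b\<close> one letter at a time visits exactly
  the positions between them. Prefix-closedness keeps this chain inside \<open>P\<close>.\<close>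

lemma simple_path_between:
  assumes "prefix_closed P" "b \<in> P" "prefix a b"
  shows "\<exists>p. simple_path (position_graph P) a b p \<and> set p = {c. prefix a c \<and> prefix c b}"
  using assms(2,3)
proof (induction b rule: rev_induct)
  case Nil
  then show ?case
    by (auto simp: simple_path_def intro!: exI[of _ "[[]]"])
next
  case (snoc i b)
  show ?case
  proof (cases "a = b @ [i]")
    case True
    then show ?thesis using snoc.prems
      by (intro exI[of _ "[a]"]) (auto simp: simple_path_def intro: prefix_order.antisym)
  next
    case False
    with snoc.prems have ab: "prefix a b" and b: "b \<in> P"
      using assms(1) unfolding prefix_closed_def by (auto simp: prefix_snoc)
    from snoc.IH[OF b ab] obtain p where
      p: "simple_path (position_graph P) a b p" "set p = {c. prefix a c \<and> prefix c b}" by blast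
    have "b @ [i] \<notin> set p" using p by auto
    moreover have "{b, b @ [i]} \<in> edges (position_graph P)"
      using snoc.prems by (simp add: edges_position_graph_iff)
    ultimately have "simple_path (position_graph P) a (b @ [i]) (p @ [b @ [i]])"
      using p snoc.prems by (auto simp: simple_path_def successively_append_iff)
    moreover have "set (p @ [b @ [i]]) = {c. prefix a c \<and> prefix c (b @ [i])}"
      unfolding set_append p(2) using snoc.prems(2) by auto
    ultimately show ?thesis by blast
  qed
qed

text \<open>One inclusion is the chain of prefixes. The other is uniqueness of paths in a tree: an
  arbitrary simple path is confined to a subtree, and to complements of subtrees, each with a single
  boundary vertex.\<close>

lemma path_verts_position_graph:
  assumes "prefix_closed P" "b \<in> P" "prefix a b"
  shows "path_verts (position_graph P) a b = {c. prefix a c \<and> prefix c b}"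
proof
  show "{c. prefix a c \<and> prefix c b} \<subseteq> path_verts (position_graph P) a b"
    using simple_path_between[OF assms] unfolding path_verts_def by blast
next
  show "path_verts (position_graph P) a b \<subseteq> {c. prefix a c \<and> prefix c b}"
  proof
    fix x assume "x \<in> path_verts (position_graph P) a b"
    then obtain p where x: "x \<in> set p" and p: "p \<noteq> []" "hd p = a" "last p = b" "distinct p"
      "successively (\<lambda>u v. {u, v} \<in> edges (position_graph P)) p"
      by (auto simp: path_verts_def simple_path_def)
    \<comment> \<open>The subtree at \<open>a\<close> is joined to the rest only through
      \<open>a\<close>.\<close>
    have "set p \<subseteq> {q. prefix a q}"
      by (rule distinct_path_stays[OF p(5,4,1), where w = a])
        (use p assms(3) in \<open>auto simp: edges_position_graph_iff prefix_snoc\<close>)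
    moreover have "prefix x b"
    proof (rule ccontr)
      assume nx: "\<not> prefix x b"
      then have "\<not> prefix x a" using assms(3) prefix_order.trans by blast
      \<comment> \<open>The complement of the subtree at \<open>x\<close> is joined to that subtree
        only through the parent \<open>butlast x\<close>; \<open>x\<close> is nonempty because it is
        not a prefix of \<open>b\<close>.\<close>
      have "set p \<subseteq> {q. \<not> prefix x q}"
        by (rule distinct_path_stays[OF p(5,4,1), where w = "butlast x"])
          (use p nx \<open>\<not> prefix x a\<close> in \<open>auto simp: edges_position_graph_iff prefix_snoc\<close>)
      then show False using x by auto
    qed
    ultimately show "x \<in> {c. prefix a c \<and> prefix c b}" using x by auto
  qed
qed

lemma path_verts_to_root:
  assumes "prefix_closed P" "b \<in> P"
  shows "path_verts (position_graph P) b [] = {c. prefix c b}"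
  using path_verts_position_graph[OF assms, of "[]"] by (simp add: path_verts_commute[of _ b])

lemma path_verts_subset_verts: "path_verts G a b \<subseteq> verts G"
  by (auto simp: path_verts_def simple_path_def)

lemma path_verts_nonempty_ends: "path_verts G a b \<noteq> {} \<Longrightarrow> a \<in> verts G \<and> b \<in> verts G"
  by (auto simp: path_verts_def simple_path_def)

text \<open>The chain from one position up to the meet \<open>v\<close>, followed by the chain down
  to the other, is a simple path, because the two chains share only \<open>v\<close>.\<close>

lemma meet_in_path_verts:
  assumes P: "prefix_closed P" and v: "v @ i # p \<in> P" "v @ j # q \<in> P" and ij: "i \<noteq> j"
  shows "v \<in> path_verts (position_graph P) (v @ i # p) (v @ j # q)"
proof -
  let ?a = "v @ i # p" and ?b = "v @ j # q"
  obtain ps where ps: "simple_path (position_graph P) v ?a ps" "set ps = {c. prefix v c \<and> prefix c ?a}"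
    using simple_path_between[OF P v(1), of v] by auto
  obtain qs where qs: "simple_path (position_graph P) v ?b qs" "set qs = {c. prefix v c \<and> prefix c ?b}"
    using simple_path_between[OF P v(2), of v] by auto
  obtain qs' where qs': "qs = v # qs'" using qs by (cases qs) (auto simp: simple_path_def)
  have ps': "simple_path (position_graph P) ?a v (rev ps)" using simple_path_rev[OF ps(1)] .
  have "c = v" if "prefix v c" "prefix c ?a" "prefix c ?b" for c
  proof -
    from that obtain r where c: "c = v @ r" by (auto simp: prefix_def)
    then show ?thesis using that ij by (cases r) auto
  qed
  then have disj: "set ps \<inter> set qs \<subseteq> {v}" using ps qs by auto
  have "qs' \<noteq> []" using qs qs' by (auto simp: simple_path_def)
  have "simple_path (position_graph P) ?a ?b (rev ps @ qs')"
    using ps' qs(1) disj \<open>qs' \<noteq> []\<close> unfolding qs' simple_path_def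
    by (auto simp: successively_append_iff successively_Cons)
  moreover have "v \<in> set ps" using ps by (auto simp: simple_path_def)
  ultimately show ?thesis unfolding path_verts_def by auto
qed

section \<open>Children, arities and the subtree \<open>T_I\<close>\<close>

lemma children_position_graph:
  assumes "prefix_closed P"
  shows "children (position_graph P) v = {v @ [i] |i. v @ [i] \<in> P}"
proof -
  have "w \<in> children (position_graph P) v \<longleftrightarrow> (\<exists>i. w = v @ [i] \<and> w \<in> P)" for w
  proof (cases "w \<in> P")
    case True
    then show ?thesis
      by (auto simp: children_def path_verts_to_root[OF assms] edges_position_graph_iff)
  next
    case False
    then show ?thesis using path_verts_nonempty_ends[of "position_graph P" w "[]"]
      by (auto simp: children_def)
  qed
  then show ?thesis by auto
qed

lemma arity_position_graph:
  assumes "prefix_closed P"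
  shows "arity (position_graph P) v = card {i. v @ [i] \<in> P}"
proof -
  have "{v @ [i] |i. v @ [i] \<in> P} = (\<lambda>i. v @ [i]) ` {i. v @ [i] \<in> P}" by auto
  then show ?thesis
    by (simp add: arity_def children_position_graph[OF assms] card_image inj_on_def)
qed

text \<open>The path from a position to the root consists of its prefixes, so for a set
  \<open>I\<close> of leaves this is the vertex set of \<open>T_I\<close>.\<close>

definition span :: "'a list set \<Rightarrow> 'a list set" where
  "span I = {p. \<exists>a\<in>I. prefix p a}"

lemma prefix_closed_span: "prefix_closed (span I)"
  by (auto simp: prefix_closed_def span_def intro: prefix_order.trans)

text \<open>Makes every fact about position graphs available for \<open>T_I\<close>. The edges agree
  because an edge lies on the path from \<open>a\<close> to the root exactly if its lower end is a
  prefix of \<open>a\<close>.\<close>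

lemma root_span_position_graph:
  assumes P: "prefix_closed P" and I: "I \<subseteq> P"
  shows "root_span (position_graph P) I = position_graph (span I)"
proof -
  have paths: "path_verts (position_graph P) a [] = {c. prefix c a}" if "a \<in> I" for a
    using path_verts_to_root[OF P] I that by auto
  have V: "(\<Union>a\<in>I. path_verts (position_graph P) a []) = span I"
    using paths by (auto simp: span_def)
  have "span I \<subseteq> P" using P I by (auto simp: prefix_closed_def span_def)
  then have left: "left_of (position_graph P) \<inter> span I \<times> span I = left_of (position_graph (span I))"
    by (auto simp: position_graph_def)
  have "e \<in> edges (position_graph P) \<and> (\<exists>a\<in>I. e \<subseteq> path_verts (position_graph P) a [])
      \<longleftrightarrow> e \<in> edges (position_graph (span I))" for e
  proof
    assume "e \<in> edges (position_graph P) \<and> (\<exists>a\<in>I. e \<subseteq> path_verts (position_graph P) a [])"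
    then obtain p i a where e: "e = {p, p @ [i]}" "p @ [i] \<in> P" "a \<in> I" 
      "e \<subseteq> path_verts (position_graph P) a []" by (auto simp: position_graph_def)
    then have "p @ [i] \<in> span I" using paths by (auto simp: span_def)
    then show "e \<in> edges (position_graph (span I))" using e by (auto simp: position_graph_def)
  next
    assume "e \<in> edges (position_graph (span I))"
    then obtain p i where e: "e = {p, p @ [i]}" "p @ [i] \<in> span I" by (auto simp: position_graph_def)
    then obtain a where a: "a \<in> I" "prefix (p @ [i]) a" by (auto simp: span_def)
    then have "e \<subseteq> path_verts (position_graph P) a []"
      using paths e by (auto intro: append_prefixD)
    then show "e \<in> edges (position_graph P) \<and> (\<exists>a\<in>I. e \<subseteq> path_verts (position_graph P) a [])"
      using e a \<open>span I \<subseteq> P\<close> by (auto simp: position_graph_def)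
  qed
  then have "edges (root_span (position_graph P) I) = edges (position_graph (span I))"
    by (simp add: root_span_def Let_def)
  then show ?thesis
    by (intro planar.equality) (simp_all add: root_span_def Let_def V left)
qed

section \<open>The reduction in terms of prefixes\<close>

text \<open>Positions without children are included too, since \<open>Red\<close> removes only the
  vertices of arity 1.\<close>

definition branching :: "nat list set \<Rightarrow> nat list set" where
  "branching P = {p \<in> P. card {i. p @ [i] \<in> P} \<noteq> 1}"

text \<open>The covering relation of the prefix order relative to \<open>B\<close>. On branching
  positions, up to symmetry, it gives the edges of the reduction.\<close>

definition covers :: "'a list set \<Rightarrow> 'a list \<Rightarrow> 'a list \<Rightarrow> bool" where
  "covers B a b \<longleftrightarrow> strict_prefix a b \<and> \<not> (\<exists>c\<in>B. strict_prefix a c \<and> strict_prefix c b)"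

text \<open>A path between incomparable vertices passes through their meet, which has two children and so is branching.\<close>

lemma path_verts_branching_iff:
  assumes P: "prefix_closed P" and ab: "a \<in> branching P" "b \<in> branching P"
  shows "a \<noteq> b \<and> path_verts (position_graph P) a b \<inter> branching P \<subseteq> {a, b}
    \<longleftrightarrow> covers (branching P) a b \<or> covers (branching P) b a"
proof -
  have abP: "a \<in> P" "b \<in> P" using ab by (auto simp: branching_def)
  consider "prefix a b" | "prefix b a" | "a \<parallel> b" by blast
  then show ?thesis
  proof cases
    case 1
    show ?thesis
      unfolding path_verts_position_graph[OF P abP(2) 1] covers_def
      using 1 by (auto simp: strict_prefix_def)
  next
    case 2
    show ?thesis
      unfolding path_verts_commute[of _ a] path_verts_position_graph[OF P abP(1) 2] covers_def
      using 2 by (auto simp: strict_prefix_def)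
  next
    case 3
    then obtain v i p j q where v: "i \<noteq> j" "a = v @ i # p" "b = v @ j # q"
      using parallel_decomp[OF 3] by auto
    have "v \<in> path_verts (position_graph P) a b"
      using meet_in_path_verts[OF P] v abP by auto
    moreover have "v \<in> branching P"
    proof -
      have "v @ [i] \<in> P" "v @ [j] \<in> P" "v \<in> P"
        using P abP unfolding v prefix_closed_def by (metis append.assoc append_Cons append_Nil prefixI)+
      moreover have "card {k. v @ [k] \<in> P} \<noteq> 1"
        using calculation v(1) by (metis (mono_tags) card_1_singletonE mem_Collect_eq singletonD)
      ultimately show ?thesis by (simp add: branching_def)
    qed
    moreover have "v \<noteq> a" "v \<noteq> b" using v by auto
    ultimately show ?thesis using 3 by (auto simp: covers_def strict_prefix_def)
  qed
qed

lemma verts_Red_position_graph: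
  assumes "prefix_closed P"
  shows "verts (Red (position_graph P)) = branching P"
  by (simp add: Red_def Let_def arity_position_graph[OF assms] branching_def)

lemma edges_Red_position_graph:
  assumes P: "prefix_closed P" and ab: "a \<in> branching P" "b \<in> branching P"
  shows "{a, b} \<in> edges (Red (position_graph P)) \<longleftrightarrow>
    covers (branching P) a b \<or> covers (branching P) b a"
proof -
  have B: "{v \<in> P. card {i. v @ [i] \<in> P} \<noteq> 1} = branching P" by (simp add: branching_def)
  have "{a, b} \<in> edges (Red (position_graph P)) \<longleftrightarrow>
      a \<noteq> b \<and> path_verts (position_graph P) a b \<inter> branching P \<subseteq> {a, b}"
    using ab path_verts_commute[of "position_graph P" a b]
    by (auto simp: Red_def Let_def arity_position_graph[OF P, simplified] B[simplified] doubleton_eq_iff)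
  then show ?thesis using path_verts_branching_iff[OF assms] by simp
qed

text \<open>Children of \<open>v\<close> have the form \<open>v @ [i]\<close>, and paths to the root
  are sets of prefixes. Conversely, prefix-closedness places the witnesses of
  \<open>strictly_left\<close> in \<open>P\<close>.\<close>

lemma left_of_Red_position_graph:
  assumes P: "prefix_closed P" and ab: "a \<in> branching P" "b \<in> branching P"
  shows "(a, b) \<in> left_of (Red (position_graph P)) \<longleftrightarrow> strictly_left a b"
proof -
  have B: "{v \<in> P. card {i. v @ [i] \<in> P} \<noteq> 1} = branching P" by (simp add: branching_def)
  have abP: "a \<in> P" "b \<in> P" using ab by (auto simp: branching_def)
  have "(a, b) \<in> left_of (Red (position_graph P)) \<longleftrightarrow>
      (\<exists>v\<in>P. \<exists>c\<in>children (position_graph P) v. \<exists>c'\<in>children (position_graph P) v.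
        (c, c') \<in> left_of (position_graph P) \<and> prefix c a \<and> prefix c' b)"
    using ab by (simp add: Red_def Let_def arity_position_graph[OF P, simplified] B[simplified]
        path_verts_to_root[OF P] abP)
  also have "\<dots> \<longleftrightarrow> strictly_left a b"
  proof
    assume "strictly_left a b"
    then obtain v i j where v: "i < j" "prefix (v @ [i]) a" "prefix (v @ [j]) b"
      by (auto simp: strictly_left_def)
    then have "v @ [i] \<in> P" "v @ [j] \<in> P" "v \<in> P"
      using P abP append_prefixD unfolding prefix_closed_def by blast+
    with v show "\<exists>v\<in>P. \<exists>c\<in>children (position_graph P) v. \<exists>c'\<in>children (position_graph P) v.
        (c, c') \<in> left_of (position_graph P) \<and> prefix c a \<and> prefix c' b"
      unfolding children_position_graph[OF P]
      by (intro bexI[of _ v] bexI[of _ "v @ [i]"] bexI[of _ "v @ [j]"]) (auto simp: position_graph_def)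
  qed (auto simp: strictly_left_def position_graph_def)
  finally show ?thesis .
qed

lemma card_prefixes: "card {c. prefix c b} = Suc (length b)"
  by (metis card_set_prefixes set_prefixes_eq)

text \<open>The path from \<open>b\<close> to the root has \<open>Suc (length b)\<close> vertices,
  so \<open>ARG_MIN\<close> selects a shortest branching position. As \<open>r\<close> is a prefix
  of all of them, no other one is equally short.\<close>

lemma rt_Red_position_graph:
  assumes P: "prefix_closed P" and r: "r \<in> branching P" "\<And>b. b \<in> branching P \<Longrightarrow> prefix r b"
  shows "rt (Red (position_graph P)) = r"
proof -
  have B: "{v \<in> P. card {i. v @ [i] \<in> P} \<noteq> 1} = branching P" by (simp add: branching_def)
  have card: "card (path_verts (position_graph P) b []) = Suc (length b)" if "b \<in> branching P" for b
    using that path_verts_to_root[OF P] card_prefixes by (auto simp: branching_def)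
  let ?f = "\<lambda>v. card (path_verts (position_graph P) v [])"
  have "rt (Red (position_graph P)) = (ARG_MIN ?f v. v \<in> branching P)"
    by (simp add: Red_def Let_def arity_position_graph[OF P, simplified] B[simplified])
  also have "\<dots> = r"
  proof (rule arg_minI)
    fix y assume "y \<in> branching P"
    then show "\<not> ?f y < ?f r"
      using card r prefix_length_le by (auto simp: not_less)
  next
    fix x assume x: "x \<in> branching P" "\<forall>y. y \<in> branching P \<longrightarrow> \<not> ?f y < ?f x"
    then have "length x \<le> length r" using card r(1) by (auto simp: not_less)
    then show "x = r" using r(2)[OF x(1)] prefix_length_le
      by (metis prefix_def append_eq_conv_conj le_antisym take_all_iff)
  qed (fact r(1))
  finally show ?thesis .
qed

section \<open>Isomorphisms\<close>

lemma positions_Nil [simp]: "[] \<in> positions t"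
  by (cases t) simp

lemma positions_Cons_iff [simp]:
  "i # p \<in> positions (Node ts) \<longleftrightarrow> i < length ts \<and> p \<in> positions (ts ! i)"
  by auto

declare positions.simps [simp del]

lemma prefix_closed_positions: "prefix_closed (positions t)"
proof -
  have "p \<in> positions t" if "q \<in> positions t" "prefix p q" for p q
    using that
  proof (induction p arbitrary: q t)
    case (Cons i p)
    then obtain r where "q = i # r" "prefix p r" by (auto simp: prefix_def)
    with Cons show ?case by (cases t) auto
  qed simp
  then show ?thesis by (auto simp: prefix_closed_def)
qed

lemma positions_eq_iff: "positions t = positions u \<longleftrightarrow> t = u"
proof
  show "positions t = positions u \<Longrightarrow> t = u"
  proof (induction t arbitrary: u)
    case (Node ts)
    obtain us where u: "u = Node us" by (cases u)
    have iff: "i < length ts \<and> p \<in> positions (ts ! i) \<longleftrightarrow> i < length us \<and> p \<in> positions (us ! i)" for i p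
      using Node.prems unfolding u by (metis positions_Cons_iff)
    \<comment> \<open>The case \<open>p = []\<close> tells which child numbers occur, hence how many
      subtrees there are.\<close>
    have len: "length ts = length us"
      using iff[of _ "[]"] by simp (metis linorder_neqE_nat less_irrefl)
    moreover have "ts ! i = us ! i" if "i < length ts" for i
      using that len iff[of i] by (intro Node.IH) auto
    ultimately show ?case unfolding u by (simp add: list_eq_iff_nth_eq)
  qed
qed simp

lemma children_tree_graph: "children (tree_graph t) p = {p @ [i] |i. p @ [i] \<in> positions t}"
  by (simp add: tree_graph_eq children_position_graph prefix_closed_positions)

text \<open>No child number is skipped here, in contrast to \<open>T_I\<close>. So the number of a
  child is its rank among its siblings, which makes a tree recoverable from its graph.\<close>

lemma positions_children:
  assumes "p \<in> positions t"
  shows "\<exists>n. \<forall>i. p @ [i] \<in> positions t \<longleftrightarrow> i < n"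
  using assms
proof (induction p arbitrary: t)
  case Nil
  then show ?case by (cases t) auto
next
  case (Cons j p)
  then show ?case by (cases t) auto
qed

section \<open>Transport along isomorphisms\<close>

text \<open>The condition of \<open>planar_iso\<close> for an explicit map, so that two isomorphisms
  can be compared pointwise.\<close>

definition is_iso :: "('v \<Rightarrow> 'w) \<Rightarrow> 'v planar \<Rightarrow> 'w planar \<Rightarrow> bool" where
  "is_iso \<phi> G H \<longleftrightarrow> bij_betw \<phi> (verts G) (verts H) \<and> \<phi> (rt G) = rt H \<and>
     (\<forall>a\<in>verts G. \<forall>b\<in>verts G. {a, b} \<in> edges G \<longleftrightarrow> {\<phi> a, \<phi> b} \<in> edges H) \<and>
     (\<forall>v\<in>verts G. \<forall>a\<in>children G v. \<forall>b\<in>children G v.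
        (a, b) \<in> left_of G \<longleftrightarrow> (\<phi> a, \<phi> b) \<in> left_of H)"

lemma planar_iso_iff: "planar_iso G H \<longleftrightarrow> (\<exists>\<phi>. is_iso \<phi> G H)"
  by (simp add: planar_iso_def is_iso_def)

lemma simple_path_iso:
  assumes \<phi>: "is_iso \<phi> G H" and p: "set p \<subseteq> verts G" "a \<in> verts G" "b \<in> verts G"
  shows "simple_path H (\<phi> a) (\<phi> b) (map \<phi> p) \<longleftrightarrow> simple_path G a b p"
proof (cases "p = []")
  case False
  have inj: "inj_on \<phi> (verts G)" and im: "\<phi> ` verts G = verts H"
    using \<phi> by (auto simp: is_iso_def bij_betw_def)
  have "successively (\<lambda>u v. {u, v} \<in> edges H) (map \<phi> p) \<longleftrightarrow>
      successively (\<lambda>u v. {u, v} \<in> edges G) p"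
    unfolding successively_map
  proof (rule successively_cong)
    fix u v assume "u \<in> set p" "v \<in> set p"
    then have "u \<in> verts G" "v \<in> verts G" using p by auto
    then show "{\<phi> u, \<phi> v} \<in> edges H \<longleftrightarrow> {u, v} \<in> edges G" using \<phi> by (simp add: is_iso_def)
  qed simp
  moreover have "distinct (map \<phi> p) \<longleftrightarrow> distinct p"
    using inj p by (auto simp: distinct_map intro: inj_on_subset)
  moreover have "hd p \<in> verts G" "last p \<in> verts G" using False p(1) hd_in_set last_in_set by blast+
  moreover have "hd (map \<phi> p) = \<phi> a \<longleftrightarrow> hd p = a"
    using False inj_on_eq_iff[OF inj] \<open>hd p \<in> verts G\<close> p(2) by (simp add: hd_map)
  moreover have "last (map \<phi> p) = \<phi> b \<longleftrightarrow> last p = b"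
    using False inj_on_eq_iff[OF inj] \<open>last p \<in> verts G\<close> p(3) by (simp add: last_map)
  moreover have "set (map \<phi> p) \<subseteq> verts H" using p im by auto
  ultimately show ?thesis using False p by (simp add: simple_path_def)
qed (simp add: simple_path_def)

lemma path_verts_iso:
  assumes \<phi>: "is_iso \<phi> G H" and ab: "a \<in> verts G" "b \<in> verts G"
  shows "path_verts H (\<phi> a) (\<phi> b) = \<phi> ` path_verts G a b"
proof
  show "\<phi> ` path_verts G a b \<subseteq> path_verts H (\<phi> a) (\<phi> b)"
  proof
    fix w assume "w \<in> \<phi> ` path_verts G a b"
    then obtain p v where p: "simple_path G a b p" "v \<in> set p" "w = \<phi> v"
      by (auto simp: path_verts_def)
    then have "simple_path H (\<phi> a) (\<phi> b) (map \<phi> p)"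
      using simple_path_iso[OF \<phi> _ ab, of p] by (simp add: simple_path_def)
    with p show "w \<in> path_verts H (\<phi> a) (\<phi> b)" by (auto simp: path_verts_def)
  qed
next
  show "path_verts H (\<phi> a) (\<phi> b) \<subseteq> \<phi> ` path_verts G a b"
  proof
    fix w assume "w \<in> path_verts H (\<phi> a) (\<phi> b)"
    then obtain q where q: "simple_path H (\<phi> a) (\<phi> b) q" "w \<in> set q"
      by (auto simp: path_verts_def)
    then have "set q \<subseteq> \<phi> ` verts G"
      using \<phi> by (auto simp: simple_path_def is_iso_def bij_betw_def)
    then have "q \<in> map \<phi> ` lists (verts G)" unfolding lists_image[symmetric] by auto
    then obtain p where p: "q = map \<phi> p" "set p \<subseteq> verts G" by auto
    then have "simple_path G a b p" using simple_path_iso[OF \<phi> _ ab] q by simp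
    then show "w \<in> \<phi> ` path_verts G a b" using p q by (auto simp: path_verts_def)
  qed
qed

lemma children_subset_verts: "children G v \<subseteq> verts G"
  using path_verts_nonempty_ends unfolding children_def by fastforce

text \<open>Children are defined through edges and paths to the root. An isomorphism respects edges
  and root, and therefore paths.\<close>

lemma children_iso:
  assumes \<phi>: "is_iso \<phi> G H" and v: "v \<in> verts G" and rt: "rt G \<in> verts G"
  shows "children H (\<phi> v) = \<phi> ` children G v"
proof -
  have inj: "inj_on \<phi> (verts G)" and im: "\<phi> ` verts G = verts H"
    and rt': "rt H = \<phi> (rt G)"
    using \<phi> by (auto simp: is_iso_def bij_betw_def)
  have iff: "\<phi> w \<in> children H (\<phi> v) \<longleftrightarrow> w \<in> children G v" if "w \<in> verts G" for w
  proof -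
    have "{\<phi> v, \<phi> w} \<in> edges H \<longleftrightarrow> {v, w} \<in> edges G"
      using \<phi> v that by (simp add: is_iso_def)
    moreover have "\<phi> v = \<phi> w \<longleftrightarrow> v = w" using inj v that by (auto simp: inj_on_def)
    moreover have "\<phi> v \<in> path_verts H (\<phi> w) (rt H) \<longleftrightarrow> v \<in> path_verts G w (rt G)"
      unfolding rt' path_verts_iso[OF \<phi> that rt]
      by (rule inj_on_image_mem_iff[OF inj v path_verts_subset_verts])
    ultimately show ?thesis by (simp add: children_def)
  qed
  show ?thesis
  proof (intro equalityI subsetI)
    fix w assume w: "w \<in> children H (\<phi> v)"
    then have "w \<in> \<phi> ` verts G" unfolding im by (rule subsetD[OF children_subset_verts])
    then obtain u where "u \<in> verts G" "w = \<phi> u" by blast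
    then show "w \<in> \<phi> ` children G v" using iff w by simp
  next
    fix w assume "w \<in> \<phi> ` children G v"
    then obtain u where u: "u \<in> children G v" "w = \<phi> u" by blast
    then show "w \<in> children H (\<phi> v)"
      using iff subsetD[OF children_subset_verts u(1)] by simp
  qed
qed

section \<open>Uniqueness of the tree isomorphic to a graph\<close>

text \<open>A finite linear order has only one increasing enumeration. If the two agree below
  \<open>i\<close>, then \<open>f i\<close> and \<open>g i\<close> occur in the other enumeration at
  indices \<open>j\<close> and \<open>k\<close> not below \<open>i\<close>, and the order excludes
  that both lie above \<open>i\<close>.\<close>

lemma order_enumeration_unique:
  fixes f g :: "nat \<Rightarrow> 'v"
  assumes f: "bij_betw f {..<m} S" "\<And>i j. i < m \<Longrightarrow> j < m \<Longrightarrow> (f i, f j) \<in> R \<longleftrightarrow> i < j"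
    and g: "bij_betw g {..<n} S" "\<And>i j. i < n \<Longrightarrow> j < n \<Longrightarrow> (g i, g j) \<in> R \<longleftrightarrow> i < j"
  shows "m = n \<and> (\<forall>i<n. f i = g i)"
proof -
  have "m = n" using f(1) g(1) by (metis bij_betw_same_card card_lessThan)
  moreover have "f i = g i" if "i < n" for i
    using that
  proof (induction i rule: less_induct)
    case (less i)
    have im: "f ` {..<n} = S" "g ` {..<n} = S" and inj: "inj_on f {..<n}" "inj_on g {..<n}"
      using f g \<open>m = n\<close> by (auto simp: bij_betw_def)
    obtain j where j: "j < n" "f i = g j" using im less.prems by blast
    obtain k where k: "k < n" "g i = f k" using im less.prems by blast
    have "\<not> j < i"
    proof
      assume "j < i"
      then have "f i = f j" using less.IH j by simp
      then have "i = j" by (rule inj_onD[OF inj(1)]) (use j less.prems in simp_all)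
      then show False using \<open>j < i\<close> by simp
    qed
    moreover have "\<not> k < i"
    proof
      assume "k < i"
      then have "g i = g k" using less.IH k by simp
      then have "i = k" by (rule inj_onD[OF inj(2)]) (use k less.prems in simp_all)
      then show False using \<open>k < i\<close> by simp
    qed
    \<comment> \<open>\<open>(f i, f k)\<close> and \<open>(g j, g i)\<close> are the same pair:
      \<open>i < k\<close> puts it into \<open>R\<close>, and \<open>i < j\<close> keeps it
      out.\<close>
    moreover have "\<not> (i < k \<and> i < j)"
      using f(2)[of i k] g(2)[of j i] j k less.prems \<open>m = n\<close> by auto
    ultimately consider "i = j" | "i = k" by linarith
    then show ?case using j k by cases auto
  qed
  ultimately show ?thesis by blast
qed

text \<open>Brings an isomorphism into the form that \<open>order_enumeration_unique\<close> needs,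
  an increasing enumeration of the children at each vertex.\<close>

lemma tree_graph_iso_enumerates_children:
  assumes \<phi>: "is_iso \<phi> (tree_graph t) G" and p: "p \<in> positions t"
    and n: "\<And>i. p @ [i] \<in> positions t \<longleftrightarrow> i < n"
  shows "bij_betw (\<lambda>i. \<phi> (p @ [i])) {..<n} (children G (\<phi> p))"
    and "\<And>i j. i < n \<Longrightarrow> j < n \<Longrightarrow> (\<phi> (p @ [i]), \<phi> (p @ [j])) \<in> left_of G \<longleftrightarrow> i < j"
proof -
  have inj: "inj_on \<phi> (positions t)" using \<phi> by (auto simp: is_iso_def bij_betw_def tree_graph_eq)
  have "children G (\<phi> p) = \<phi> ` children (tree_graph t) p"
    by (rule children_iso[OF \<phi>]) (simp_all add: tree_graph_eq p)
  also have "\<dots> = (\<lambda>i. \<phi> (p @ [i])) ` {..<n}" by (auto simp: children_tree_graph n)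
  finally have "children G (\<phi> p) = (\<lambda>i. \<phi> (p @ [i])) ` {..<n}" .
  moreover have "inj_on (\<lambda>i. \<phi> (p @ [i])) {..<n}"
    using inj n by (fastforce simp: inj_on_def)
  ultimately show "bij_betw (\<lambda>i. \<phi> (p @ [i])) {..<n} (children G (\<phi> p))"
    by (simp add: bij_betw_def)
  fix i j assume ij: "i < n" "j < n"
  then have "p @ [i] \<in> children (tree_graph t) p" "p @ [j] \<in> children (tree_graph t) p"
    by (auto simp: children_tree_graph n)
  then have "(\<phi> (p @ [i]), \<phi> (p @ [j])) \<in> left_of G \<longleftrightarrow> (p @ [i], p @ [j]) \<in> left_of (tree_graph t)"
    using \<phi> p by (auto simp: is_iso_def tree_graph_eq)
  also have "\<dots> \<longleftrightarrow> i < j" using ij n by (auto simp: tree_graph_def)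
  finally show "(\<phi> (p @ [i]), \<phi> (p @ [j])) \<in> left_of G \<longleftrightarrow> i < j" .
qed

text \<open>Descent from the root: where the two maps agree, both enumerate the same children in the
  same order, so they agree on these too. The position sets then coincide, and they determine the
  tree.\<close>

lemma tree_graph_iso_unique:
  assumes \<phi>: "is_iso \<phi> (tree_graph t) G" and \<psi>: "is_iso \<psi> (tree_graph u) G"
  shows "t = u"
proof -
  have agree: "(p \<in> positions t \<longleftrightarrow> p \<in> positions u) \<and> (p \<in> positions t \<longrightarrow> \<phi> p = \<psi> p)" for p
  proof (induction p rule: rev_induct)
    case Nil
    then show ?case using \<phi> \<psi> by (simp add: is_iso_def tree_graph_def)
  next
    case (snoc i p)
    show ?case
    proof (cases "p \<in> positions t")
      case True
      with snoc have eq: "p \<in> positions u" "\<phi> p = \<psi> p" by auto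
      obtain m where m: "\<And>i. p @ [i] \<in> positions t \<longleftrightarrow> i < m" using positions_children True by blast
      obtain n where n: "\<And>i. p @ [i] \<in> positions u \<longleftrightarrow> i < n" using positions_children eq(1) by blast
      have "m = n \<and> (\<forall>i<n. \<phi> (p @ [i]) = \<psi> (p @ [i]))"
        using tree_graph_iso_enumerates_children[OF \<phi> True m]
          tree_graph_iso_enumerates_children[OF \<psi> eq(1) n] unfolding eq(2)
        by (rule order_enumeration_unique)
      then show ?thesis using m n by auto
    next
      case False
      then show ?thesis
        using snoc prefix_closed_positions append_prefixD unfolding prefix_closed_def
        by (metis prefixI)
    qed
  qed
  then have "positions t = positions u" by auto
  then show ?thesis by (simp add: positions_eq_iff)
qed

lemma iso_class_eqI:
  assumes "reduced t" "is_iso \<phi> (tree_graph t) G"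
  shows "iso_class G = Abs_prt t"
  unfolding iso_class_def
proof (rule the_equality)
  have "Rep_prt (Abs_prt t) = t" using assms(1) by (simp add: Abs_prt_inverse)
  then show "planar_iso (tree_graph (Rep_prt (Abs_prt t))) G"
    using assms(2) by (auto simp: planar_iso_iff)
next
  fix s assume "planar_iso (tree_graph (Rep_prt s)) G"
  then obtain \<psi> where "is_iso \<psi> (tree_graph (Rep_prt s)) G" by (auto simp: planar_iso_iff)
  then have "Rep_prt s = t" using tree_graph_iso_unique assms(2) by blast
  then show "s = Abs_prt t" by (metis Rep_prt_inverse)
qed

section \<open>Order isomorphisms\<close>

text \<open>These two relations determine the reduced graph, and maps respecting them are easily
  built by recursion over the tree. Injectivity follows because the prefix order is
  reflected.\<close>

definition order_iso :: "(nat list \<Rightarrow> nat list) \<Rightarrow> nat list set \<Rightarrow> nat list set \<Rightarrow> bool" where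
  "order_iso \<phi> A B \<longleftrightarrow> \<phi> ` A = B \<and>
    (\<forall>a\<in>A. \<forall>b\<in>A. (prefix (\<phi> a) (\<phi> b) \<longleftrightarrow> prefix a b) \<and>
      (strictly_left (\<phi> a) (\<phi> b) \<longleftrightarrow> strictly_left a b))"

lemma order_iso_inj_on: "order_iso \<phi> A B \<Longrightarrow> inj_on \<phi> A"
  unfolding order_iso_def inj_on_def by (metis prefix_order.antisym prefix_order.refl)

lemma covers_order_iso:
  assumes \<phi>: "order_iso \<phi> A B" and ab: "a \<in> A" "b \<in> A"
  shows "covers B (\<phi> a) (\<phi> b) \<longleftrightarrow> covers A a b"
proof -
  have strict: "strict_prefix (\<phi> a) (\<phi> b) \<longleftrightarrow> strict_prefix a b" if "a \<in> A" "b \<in> A" for a b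
    using \<phi> order_iso_inj_on[OF \<phi>] that
    unfolding order_iso_def strict_prefix_def inj_on_def by blast
  have B: "B = \<phi> ` A" using \<phi> by (auto simp: order_iso_def)
  show ?thesis using ab by (simp add: covers_def B strict)
qed

text \<open>Turns the edges of a tree graph into covering pairs, so that they can be matched with
  the edges of the reduction.\<close>

lemma covers_prefix_closed_iff:
  assumes "prefix_closed P" "b \<in> P"
  shows "covers P a b \<longleftrightarrow> (\<exists>i. b = a @ [i])"
proof
  assume cov: "covers P a b"
  then obtain r where b: "b = a @ r" "r \<noteq> []" by (auto simp: covers_def strict_prefix_def prefix_def)
  then obtain i s where r: "r = i # s" by (cases r) auto
  have "s = []"
  proof (rule ccontr)
    assume "s \<noteq> []"
    then have "strict_prefix a (a @ [i])" "strict_prefix (a @ [i]) b"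
      using b r by (auto simp: strict_prefix_def)
    moreover have "a @ [i] \<in> P"
      using assms b r unfolding prefix_closed_def by (metis append.assoc append_Cons append_Nil prefixI)
    ultimately show False using cov by (auto simp: covers_def)
  qed
  then show "\<exists>i. b = a @ [i]" using b r by simp
next
  assume "\<exists>i. b = a @ [i]"
  then show "covers P a b" by (auto simp: covers_def strict_prefix_def)
qed

lemma strictly_left_siblings: "strictly_left (p @ [i]) (p @ [j]) \<longleftrightarrow> i < j"
proof
  assume "strictly_left (p @ [i]) (p @ [j])"
  then obtain v k l where v: "k < l" "prefix (v @ [k]) (p @ [i])" "prefix (v @ [l]) (p @ [j])"
    by (auto simp: strictly_left_def)
  have "\<not> (prefix (v @ [k]) p \<and> prefix (v @ [l]) p)"
    using v(1) by (auto simp: prefix_def)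
  moreover have "length v < length p" if "prefix (v @ [m]) p" for m
    using prefix_length_le[OF that] by simp
  ultimately show "i < j" using v by (auto simp: prefix_snoc)
qed (auto simp: strictly_left_def)

text \<open>All of the reduced graph is order data: the vertices are the branching positions, the
  root is their least element, the edges are the covering pairs, and the left-to-right order is
  \<open>strictly_left\<close>.\<close>

lemma is_iso_Red:
  assumes P: "prefix_closed P" and \<phi>: "order_iso \<phi> (positions t) (branching P)"
  shows "is_iso \<phi> (tree_graph t) (Red (position_graph P))"
  unfolding is_iso_def
proof (intro conjI ballI)
  have im: "\<phi> ` positions t = branching P" using \<phi> by (simp add: order_iso_def)
  then have mem: "\<phi> a \<in> branching P" if "a \<in> positions t" for a using that by auto
  show "bij_betw \<phi> (verts (tree_graph t)) (verts (Red (position_graph P)))"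
    using im order_iso_inj_on[OF \<phi>]
    by (simp add: bij_betw_def tree_graph_eq verts_Red_position_graph[OF P])
  show "\<phi> (rt (tree_graph t)) = rt (Red (position_graph P))"
  proof -
    have "prefix (\<phi> []) b" if "b \<in> branching P" for b
    proof -
      from that im obtain a where "a \<in> positions t" "b = \<phi> a" by auto
      then show ?thesis using \<phi> by (simp add: order_iso_def)
    qed
    then show ?thesis
      using rt_Red_position_graph[OF P mem[of "[]"]] by (simp add: tree_graph_eq)
  qed
  fix a b assume "a \<in> verts (tree_graph t)" "b \<in> verts (tree_graph t)"
  then have ab: "a \<in> positions t" "b \<in> positions t" by (simp_all add: tree_graph_eq)
  show "{a, b} \<in> edges (tree_graph t) \<longleftrightarrow> {\<phi> a, \<phi> b} \<in> edges (Red (position_graph P))"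
    unfolding edges_Red_position_graph[OF P mem[OF ab(1)] mem[OF ab(2)]]
    using ab by (auto simp: covers_order_iso[OF \<phi>] covers_prefix_closed_iff[OF prefix_closed_positions]
        tree_graph_eq edges_position_graph_iff)
next
  fix v a b
  assume "a \<in> children (tree_graph t) v" "b \<in> children (tree_graph t) v"
  then obtain i j where ij: "a = v @ [i]" "b = v @ [j]" "a \<in> positions t" "b \<in> positions t"
    by (auto simp: children_tree_graph)
  have "\<phi> a \<in> branching P" "\<phi> b \<in> branching P" using \<phi> ij by (auto simp: order_iso_def)
  then have "(\<phi> a, \<phi> b) \<in> left_of (Red (position_graph P)) \<longleftrightarrow> strictly_left a b"
    using \<phi> ij(3,4) by (simp add: left_of_Red_position_graph[OF P] order_iso_def)
  then show "(a, b) \<in> left_of (tree_graph t) \<longleftrightarrow> (\<phi> a, \<phi> b) \<in> left_of (Red (position_graph P))"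
    using ij by (auto simp: strictly_left_siblings tree_graph_def)
qed

section \<open>Restriction of a tree to a set of leaves\<close>

lemma strictly_left_simps [simp]:
  "\<not> strictly_left [] q" "\<not> strictly_left p []"
  "strictly_left (i # p) (j # q) \<longleftrightarrow> i < j \<or> i = j \<and> strictly_left p q"
proof -
  show "strictly_left (i # p) (j # q) \<longleftrightarrow> i < j \<or> i = j \<and> strictly_left p q"
  proof
    assume "strictly_left (i # p) (j # q)"
    then obtain v k l where v: "k < l" "prefix (v @ [k]) (i # p)" "prefix (v @ [l]) (j # q)"
      by (auto simp: strictly_left_def)
    show "i < j \<or> i = j \<and> strictly_left p q"
    proof (cases v)
      case Nil
      then show ?thesis using v by simp
    next
      case (Cons a w)
      then show ?thesis using v by (auto simp: strictly_left_def)
    qed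
  next
    assume "i < j \<or> i = j \<and> strictly_left p q"
    then show "strictly_left (i # p) (j # q)"
    proof (elim disjE conjE)
      assume "i < j"
      then show ?thesis by (auto simp: strictly_left_def intro!: exI[of _ "[]"])
    next
      assume "i = j" "strictly_left p q"
      then obtain v k l where v: "k < l" "prefix (v @ [k]) p" "prefix (v @ [l]) q"
        by (auto simp: strictly_left_def)
      then have "prefix ((i # v) @ [k]) (i # p)" "prefix ((i # v) @ [l]) (j # q)"
        using \<open>i = j\<close> by simp_all
      with v(1) show ?thesis unfolding strictly_left_def by blast
    qed
  qed
qed (auto simp: strictly_left_def)

lemma order_iso_Cons:
  assumes "order_iso \<phi> A B"
  shows "order_iso (\<lambda>p. i # \<phi> p) A ((#) i ` B)"
  using assms unfolding order_iso_def by auto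

text \<open>\<open>e\<close> sends child numbers of the new tree to those of the original one. Being
  strictly increasing, it respects equality of first letters, which \<open>prefix\<close> needs, and
  their order, which \<open>strictly_left\<close> needs.\<close>

lemma order_iso_Node:
  assumes "\<And>k. k < length us \<Longrightarrow> order_iso (\<phi> k) (positions (us ! k)) (B k)"
    and e: "\<And>k l. k < length us \<Longrightarrow> l < length us \<Longrightarrow> e k < e l \<longleftrightarrow> k < l"
  shows "order_iso (\<lambda>p. case p of [] \<Rightarrow> [] | k # q \<Rightarrow> e k # \<phi> k q) (positions (Node us))
    (insert [] (\<Union>k<length us. (#) (e k) ` B k))"
proof -
  let ?\<psi> = "\<lambda>p. case p of [] \<Rightarrow> [] | k # q \<Rightarrow> e k # \<phi> k q"
  have e_eq: "e k = e l \<longleftrightarrow> k = l" if "k < length us" "l < length us" for k l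
    using e[OF that] e[OF that(2,1)] by (metis linorder_neq_iff)
  have im: "\<phi> k ` positions (us ! k) = B k" if "k < length us" for k
    using assms(1)[OF that] by (simp add: order_iso_def)
  have "?\<psi> ` positions (Node us) = insert [] (\<Union>k<length us. (#) (e k) ` B k)"
    by (simp add: positions.simps image_UN image_image im[symmetric])
  moreover have "(prefix (?\<psi> a) (?\<psi> b) \<longleftrightarrow> prefix a b) \<and>
      (strictly_left (?\<psi> a) (?\<psi> b) \<longleftrightarrow> strictly_left a b)"
    if ab: "a \<in> positions (Node us)" "b \<in> positions (Node us)" for a b
  proof (cases a)
    case (Cons k p)
    show ?thesis
    proof (cases b)
      case b: (Cons l q)
      have kl: "k < length us" "l < length us" using ab Cons b by auto
      then show ?thesis
        using Cons b ab assms(1)[of k] e[OF kl] e_eq[OF kl] by (auto simp: order_iso_def)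
    qed (simp add: Cons)
  qed simp
  ultimately show ?thesis unfolding order_iso_def by blast
qed

section \<open>Leaf sets and restriction by recursion\<close>

text \<open>For a set of leaves of a grafting this is its component in subtree number
  \<open>i\<close>.\<close>

definition sub :: "nat \<Rightarrow> nat list set \<Rightarrow> nat list set" where
  "sub i I = {p. i # p \<in> I}"

lemma mem_sub [simp]: "p \<in> sub i I \<longleftrightarrow> i # p \<in> I"
  by (simp add: sub_def)

lemma Cons_mem_span [simp]: "i # p \<in> span I \<longleftrightarrow> p \<in> span (sub i I)"
  unfolding span_def by (auto simp: prefix_def)

lemma Nil_mem_span [simp]: "[] \<in> span I \<longleftrightarrow> I \<noteq> {}"
  by (auto simp: span_def)

lemma span_empty [simp]: "span {} = {}"
  by (simp add: span_def)

lemma Cons_mem_branching_span [simp]: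
  "i # p \<in> branching (span I) \<longleftrightarrow> p \<in> branching (span (sub i I))"
  by (simp add: branching_def)

lemma Nil_mem_branching_span:
  "[] \<in> branching (span I) \<longleftrightarrow> I \<noteq> {} \<and> card {i. sub i I \<noteq> {}} \<noteq> 1"
  by (simp add: branching_def)

lemma branching_empty [simp]: "branching {} = {}"
  by (simp add: branching_def)

lemma finite_positions: "finite (positions t)"
  by (induction t) (simp add: positions.simps)

abbreviation leaf_set :: "ptree \<Rightarrow> nat list set" where
  "leaf_set t \<equiv> leaves (tree_graph t)"

text \<open>Arity is a cardinality, and \<open>card\<close> is 0 for infinite sets as well; the
  initial segments of \<open>positions_children\<close> exclude that case.\<close>

lemma leaf_set_eq: "leaf_set t = {p \<in> positions t. \<forall>i. p @ [i] \<notin> positions t}"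
proof -
  have "card {i. p @ [i] \<in> positions t} = 0 \<longleftrightarrow> (\<forall>i. p @ [i] \<notin> positions t)" if "p \<in> positions t" for p
  proof -
    obtain n where n: "\<And>i. p @ [i] \<in> positions t \<longleftrightarrow> i < n" using positions_children \<open>p \<in> _\<close> by blast
    then have "{i. p @ [i] \<in> positions t} = {..<n}" by auto
    then show ?thesis using n by (metis card_lessThan less_zeroE not_gr_zero)
  qed
  then show ?thesis
    by (auto simp: leaves_def tree_graph_eq arity_position_graph[OF prefix_closed_positions])
qed

lemma finite_leaf_set: "finite (leaf_set t)"
  by (rule finite_subset[OF _ finite_positions[of t]]) (auto simp: leaf_set_eq)

lemma Nil_mem_leaf_set [simp]: "[] \<in> leaf_set (Node ts) \<longleftrightarrow> ts = []"
  by (auto simp: leaf_set_eq)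

lemma Cons_mem_leaf_set [simp]:
  "i # p \<in> leaf_set (Node ts) \<longleftrightarrow> i < length ts \<and> p \<in> leaf_set (ts ! i)"
  by (auto simp: leaf_set_eq)

lemma leaf_set_Node_Nil: "leaf_set (Node []) = {[]}"
  by (auto simp: leaf_set_eq positions.simps)

lemma card_eq_sum_card_sub:
  assumes I: "I \<subseteq> leaf_set (Node ts)" and "ts \<noteq> []"
  shows "card I = (\<Sum>i<length ts. card (sub i I))"
proof -
  have eq: "I = (\<Union>i<length ts. (#) i ` sub i I)"
  proof (intro set_eqI)
    fix p
    show "p \<in> I \<longleftrightarrow> p \<in> (\<Union>i<length ts. (#) i ` sub i I)"
      using assms subsetD[OF I, of p] by (cases p) (auto simp: image_iff)
  qed
  have fin: "finite ((#) i ` sub i I)" for i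
    using finite_subset[OF I finite_leaf_set] by (rule finite_subset[rotated]) auto
  have "card I = (\<Sum>i<length ts. card ((#) i ` sub i I))"
    by (subst eq, rule card_UN_disjoint) (use fin in auto)
  then show ?thesis by (simp add: card_image)
qed

text \<open>The analogue of \<open>graft'\<close> for trees not yet packed into
  \<open>prt\<close>.\<close>

definition join :: "ptree option list \<Rightarrow> ptree option" where
  "join Ts = (case [t. Some t \<leftarrow> Ts] of
      [] \<Rightarrow> None
    | [t] \<Rightarrow> Some t
    | ts \<Rightarrow> Some (Node ts))"

text \<open>The recursive counterpart of \<open>T|I\<close>. A vertex of arity 1 is suppressed by
  \<open>join\<close>, when only one component survives.\<close>

function restrict_tree :: "ptree \<Rightarrow> nat list set \<Rightarrow> ptree option" where
  "restrict_tree (Node ts) I =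
    (if ts = [] then if I = {} then None else Some (Node [])
     else join (map (\<lambda>i. restrict_tree (ts ! i) (sub i I)) [0..<length ts]))"
  by pat_completeness auto
termination
  by (relation "measure (\<lambda>(t, I). size t)")
    (auto simp: less_Suc_eq_le intro!: size_list_estimation'[OF nth_mem])

declare restrict_tree.simps [simp del]

lemma keep_Some_map:
  "[t. Some t \<leftarrow> map F xs] = map (\<lambda>x. the (F x)) (filter (\<lambda>x. F x \<noteq> None) xs)"
  by (induction xs) auto

lemma keep_Some_map_option:
  "[t. Some t \<leftarrow> map (map_option f) Ts] = map f [t. Some t \<leftarrow> Ts]"
  by (induction Ts) (auto split: option.splits)

lemma restrict_tree_empty: "restrict_tree t {} = None"
proof (induction t)
  case (Node ts)
  have "sub i {} = {}" for i by (simp add: sub_def)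
  with Node show ?case by (simp add: restrict_tree.simps join_def keep_Some_map del: map_map)
qed

text \<open>The order isomorphism identifies the result with \<open>Red(T_I)\<close>; the number of
  leaves is carried along for the later finiteness of the shuffle product.\<close>

lemma restrict_tree_correct:
  assumes "reduced t" "I \<subseteq> leaf_set t" "I \<noteq> {}"
  shows "\<exists>u \<phi>. restrict_tree t I = Some u \<and> reduced u \<and> card (leaf_set u) = card I \<and>
    order_iso \<phi> (positions u) (branching (span I))"
  using assms
proof (induction t arbitrary: I)
  case (Node ts)
  show ?case
  proof (cases "ts = []")
    case True
    then have I: "I = {[]}" using Node.prems leaf_set_Node_Nil by auto
    have "branching (span I) = {[]}" by (auto simp: I span_def branching_def)
    then have "order_iso id (positions (Node [])) (branching (span I))"
      by (simp add: positions.simps order_iso_def)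
    then show ?thesis
      using True I by (auto simp: restrict_tree.simps leaf_set_Node_Nil)
  next
    case ts: False
    \<comment> \<open>\<open>J\<close> collects the subtrees that meet \<open>I\<close>, and
      \<open>js\<close> will list them from left to right.\<close>
    define F where "F i = restrict_tree (ts ! i) (sub i I)" for i
    define J where "J = {i. sub i I \<noteq> {}}"
    define js where "js = filter (\<lambda>i. F i \<noteq> None) [0..<length ts]"
    have J: "i < length ts" "sub i I \<subseteq> leaf_set (ts ! i)" if "i \<in> J" for i
      using that Node.prems(2) by (auto simp: J_def)
    have "\<exists>u \<phi>. F i = Some u \<and> reduced u \<and> card (leaf_set u) = card (sub i I) \<and>
      order_iso \<phi> (positions u) (branching (span (sub i I)))" if "i \<in> J" for i
      unfolding F_def by (rule Node.IH) (use J that Node.prems in \<open>auto simp: J_def\<close>)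
    then have "\<exists>\<phi>. \<forall>i\<in>J. F i \<noteq> None \<and> reduced (the (F i)) \<and> card (leaf_set (the (F i))) = card (sub i I) \<and>
      order_iso (\<phi> i) (positions (the (F i))) (branching (span (sub i I)))"
      by (intro bchoice) fastforce
    then obtain \<phi> where \<phi>: "\<And>i. i \<in> J \<Longrightarrow> F i \<noteq> None" "\<And>i. i \<in> J \<Longrightarrow> reduced (the (F i))"
      "\<And>i. i \<in> J \<Longrightarrow> card (leaf_set (the (F i))) = card (sub i I)"
      "\<And>i. i \<in> J \<Longrightarrow> order_iso (\<phi> i) (positions (the (F i))) (branching (span (sub i I)))"
      by blast
    have "F i = None" if "i \<notin> J" for i using that by (simp add: F_def J_def restrict_tree_empty)
    then have F: "F i \<noteq> None \<longleftrightarrow> i \<in> J" for i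
      by (cases "i \<in> J") (simp_all add: \<phi>(1))
    have set_js: "set js = J" using F J by (auto simp: js_def)
    have sorted: "sorted_wrt (<) js" unfolding js_def by (intro sorted_wrt_filter) simp
    have dist: "distinct js" by (simp add: js_def)
    have card_J: "card J = length js" using distinct_card[OF dist] set_js by simp
    have nil: "[] \<notin> I" using Node.prems(2) ts by auto
    have restr: "restrict_tree (Node ts) I =
        (case map (\<lambda>i. the (F i)) js of [] \<Rightarrow> None | [t] \<Rightarrow> Some t | us \<Rightarrow> Some (Node us))"
      using ts by (simp add: restrict_tree.simps join_def F_def[symmetric] keep_Some_map js_def del: map_map)
    \<comment> \<open>The root has one child in \<open>T_I\<close> for each element of
      \<open>J\<close>, so it disappears exactly if there is only one. Below the root, the branching
      positions are those of the components.\<close>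
    have branching: "branching (span I) = (if length js = 1 then {} else {[]}) \<union>
        (\<Union>i\<in>J. (#) i ` branching (span (sub i I)))"
    proof (intro set_eqI)
      fix p
      show "p \<in> branching (span I) \<longleftrightarrow> p \<in> (if length js = 1 then {} else {[]}) \<union>
        (\<Union>i\<in>J. (#) i ` branching (span (sub i I)))"
      proof (cases p)
        case Nil
        then show ?thesis using Node.prems(3) card_J
          by (auto simp: Nil_mem_branching_span J_def[symmetric])
      next
        case (Cons i q)
        then show ?thesis by (cases "sub i I = {}") (auto simp: J_def image_iff)
      qed
    qed
    have "card I = (\<Sum>i\<in>{..<length ts}. card (sub i I))"
      using card_eq_sum_card_sub Node.prems(2) ts by blast
    also have "\<dots> = (\<Sum>i\<in>J. card (sub i I))"
      by (rule sum.mono_neutral_right) (use J in \<open>auto simp: J_def\<close>)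
    finally have card_I: "card I = (\<Sum>i\<in>J. card (sub i I))" .
    have "J \<noteq> {}"
    proof -
      obtain p where p: "p \<in> I" using Node.prems(3) by blast
      then obtain i q where "p = i # q" using nil by (cases p) auto
      with p have "q \<in> sub i I" by simp
      then show ?thesis unfolding J_def by blast
    qed
    then have "js \<noteq> []" using set_js by auto
    then consider i where "js = [i]" | "2 \<le> length js"
      by (metis One_nat_def Suc_1 Suc_leI length_0_conv length_Suc_conv less_one linorder_neqE_nat
          not_less_eq)
    then show ?thesis
    proof cases
      \<comment> \<open>The root disappears, and the result is the single component, embedded below
        child \<open>i\<close>.\<close>
      case (1 i)
      then have "J = {i}" using set_js by auto
      then have "order_iso (\<lambda>p. i # \<phi> i p) (positions (the (F i))) (branching (span I))"
        using order_iso_Cons[OF \<phi>(4)[of i], of i] branching 1 by simp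
      then show ?thesis
        using 1 \<open>J = {i}\<close> \<phi>(2,3)[of i] card_I restr by auto
    next
      \<comment> \<open>The root stays. Child \<open>k\<close> of the result comes from child
        \<open>js ! k\<close> of the tree.\<close>
      case 2
      define us where "us = map (\<lambda>i. the (F i)) js"
      have len: "length us = length js" by (simp add: us_def)
      have us: "us ! k = the (F (js ! k))" "js ! k \<in> J" if "k < length us" for k
        using that set_js by (auto simp: us_def)
      have "restrict_tree (Node ts) I = Some (Node us)"
        using restr 2 unfolding us_def[symmetric] len[symmetric]
        by (auto split: list.splits)
      moreover have "reduced (Node us)"
        using 2 \<phi>(2) set_js by (auto simp: us_def)
      moreover have "card (leaf_set (Node us)) = card I"
      proof -
        have "sub k (leaf_set (Node us)) = leaf_set (us ! k)" if "k < length us" for k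
          using that by (auto simp: set_eq_iff)
        then have "card (leaf_set (Node us)) = (\<Sum>k<length us. card (leaf_set (us ! k)))"
          using card_eq_sum_card_sub[of "leaf_set (Node us)" us] 2 len by fastforce
        also have "\<dots> = (\<Sum>k<length js. card (sub (js ! k) I))"
          using us \<phi>(3) len by simp
        also have "\<dots> = (\<Sum>i\<in>J. card (sub i I))"
          using sum.distinct_set_conv_list[OF dist, of "\<lambda>i. card (sub i I)"]
          by (simp add: set_js sum_list_sum_nth atLeast0LessThan)
        finally show ?thesis using card_I by simp
      qed
      moreover have "order_iso (\<lambda>p. case p of [] \<Rightarrow> [] | k # q \<Rightarrow> js ! k # \<phi> (js ! k) q)
          (positions (Node us)) (branching (span I))"
      proof -
        have "js ! k < js ! l \<longleftrightarrow> k < l" if "k < length us" "l < length us" for k l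
          using that sorted_wrt_nth_less[OF sorted] len
          by (metis linorder_neqE_nat order_less_asym order_less_irrefl)
        then have "order_iso (\<lambda>p. case p of [] \<Rightarrow> [] | k # q \<Rightarrow> js ! k # \<phi> (js ! k) q)
            (positions (Node us))
            (insert [] (\<Union>k<length us. (#) (js ! k) ` branching (span (sub (js ! k) I))))"
          using \<phi>(4) us by (intro order_iso_Node) auto
        moreover have "(\<Union>k<length us. (#) (js ! k) ` branching (span (sub (js ! k) I))) =
            (\<Union>i\<in>J. (#) i ` branching (span (sub i I)))"
          unfolding set_js[symmetric] by (auto simp: set_conv_nth len)
        ultimately show ?thesis using branching 2 by simp
      qed
      ultimately show ?thesis by blast
    qed
  qed
qed

section \<open>The co-addition and the shuffle product\<close>

definition restriction :: "ptree \<Rightarrow> nat list set \<Rightarrow> prt'" where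
  "restriction t I = map_option Abs_prt (restrict_tree t I)"

text \<open>Passes from graphs to the recursion: \<open>T_I\<close> is the position graph of
  \<open>span I\<close>, and the order isomorphism onto its branching positions is a graph
  isomorphism onto the reduction.\<close>

lemma restr_eq:
  assumes I: "I \<subseteq> leaf_set (Rep_prt T)"
  shows "restr (Some T) I = restriction (Rep_prt T) I"
proof (cases "I = {}")
  case True
  then show ?thesis by (simp add: restr_def restriction_def restrict_tree_empty)
next
  case False
  let ?t = "Rep_prt T"
  obtain u \<phi> where u: "restrict_tree ?t I = Some u" "reduced u"
      "order_iso \<phi> (positions u) (branching (span I))"
    using restrict_tree_correct[OF _ I False] Rep_prt[of T] by auto
  have "I \<subseteq> positions ?t" using I by (auto simp: leaf_set_eq)
  then have "root_span (tree_graph ?t) I = position_graph (span I)"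
    by (simp add: tree_graph_eq root_span_position_graph prefix_closed_positions)
  then have "iso_class (Red (root_span (tree_graph ?t) I)) = Abs_prt u"
    using iso_class_eqI[OF u(2) is_iso_Red[OF prefix_closed_span u(3)]] by simp
  then show ?thesis using False u(1) by (simp add: restr_def restriction_def)
qed

text \<open>On reduced trees \<open>Rep_prt\<close> undoes \<open>Abs_prt\<close>, so grafting
  before or after passing to \<open>prt\<close> gives the same class.\<close>

lemma join_reduced:
  assumes "\<And>t. Some t \<in> set Ts \<Longrightarrow> reduced t"
  shows "map_option Abs_prt (join Ts) = graft' (map (map_option Abs_prt) Ts)"
proof -
  define ts where "ts = [t. Some t \<leftarrow> Ts]"
  have "set ts = {t. Some t \<in> set Ts}"
    unfolding ts_def by (induction Ts) (auto split: option.splits)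
  then have "map Rep_prt (map Abs_prt ts) = ts"
    using assms by (auto simp: Abs_prt_inverse intro!: map_idI)
  moreover have "[t. Some t \<leftarrow> map (map_option Abs_prt) Ts] = map Abs_prt ts"
    unfolding ts_def by (rule keep_Some_map_option)
  ultimately show ?thesis
    unfolding join_def graft'_def ts_def[symmetric]
    by (auto split: list.splits)
qed

lemma restrict_tree_reduced:
  assumes "reduced t" "I \<subseteq> leaf_set t" "restrict_tree t I = Some u"
  shows "reduced u" and "card (leaf_set u) = card I"
proof -
  have "I \<noteq> {}" using assms(3) by (auto simp: restrict_tree_empty)
  then show "reduced u" "card (leaf_set u) = card I"
    using restrict_tree_correct[OF assms(1,2)] assms(3) by auto
qed

lemma sub_subset_leaf_set:
  "I \<subseteq> leaf_set (Node ts) \<Longrightarrow> sub i I \<subseteq> leaf_set (ts ! i)"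
  by (auto dest: subsetD)

lemma restriction_Node:
  assumes "reduced (Node ts)" "ts \<noteq> []" "I \<subseteq> leaf_set (Node ts)"
  shows "restriction (Node ts) I = graft' (map (\<lambda>i. restriction (ts ! i) (sub i I)) [0..<length ts])"
proof -
  have "reduced u" if "Some u \<in> set (map (\<lambda>i. restrict_tree (ts ! i) (sub i I)) [0..<length ts])" for u
  proof -
    from that obtain i where i: "i < length ts" "restrict_tree (ts ! i) (sub i I) = Some u"
      by (metis (no_types, lifting) imageE list.set_map set_upt atLeastLessThan_iff)
    show ?thesis
      by (rule restrict_tree_reduced[OF _ sub_subset_leaf_set[OF assms(3)] i(2)]) (use assms i in simp)
  qed
  then have "map_option Abs_prt (join (map (\<lambda>i. restrict_tree (ts ! i) (sub i I)) [0..<length ts])) =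
      graft' (map (map_option Abs_prt) (map (\<lambda>i. restrict_tree (ts ! i) (sub i I)) [0..<length ts]))"
    by (rule join_reduced)
  then show ?thesis
    using assms(2) by (simp add: restriction_def restrict_tree.simps comp_def)
qed

section \<open>Expansion of the co-addition on trees\<close>

lemma mem_listset_iff: "xs \<in> listset As \<longleftrightarrow> list_all2 (\<in>) xs As"
  by (induction As arbitrary: xs) (auto simp: set_Cons_def list_all2_Cons2)

text \<open>The distributive law, with one choice of summand per argument.\<close>

lemma multilin_sum_basis:
  assumes "\<And>x. x \<in> set xs \<Longrightarrow> finite (A x)"
  shows "multilin G (map (\<lambda>x. \<Sum>a\<in>A x. basis (F x a)) xs) =
    (\<Sum>as\<in>listset (map A xs). G (map2 F xs as))"
  using assms
proof (induction xs arbitrary: G)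
  case (Cons x xs)
  have "set_Cons (A x) (listset (map A xs)) = (\<lambda>(a, as). a # as) ` (A x \<times> listset (map A xs))"
    by (auto simp: set_Cons_def)
  moreover have "inj_on (\<lambda>(a, as). a # as) (A x \<times> listset (map A xs))"
    by (auto simp: inj_on_def)
  ultimately have "(\<Sum>as\<in>listset (map A (x # xs)). G (map2 F (x # xs) as)) =
      (\<Sum>(a, as)\<in>A x \<times> listset (map A xs). G (F x a # map2 F xs as))"
    by (simp add: sum.reindex) (simp add: case_prod_beta)
  also have "\<dots> = multilin G (map (\<lambda>x. \<Sum>a\<in>A x. basis (F x a)) (x # xs))"
    using Cons.IH[of "\<lambda>bs. G (_ # bs)"] Cons.prems
    by (simp add: multilin_Cons linext_sum sum.cartesian_product)
  finally show ?case ..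
qed simp

text \<open>Every leaf of a grafting begins with the number of its subtree, which gives the inverse
  map. A childless root would itself be a leaf and lie in no subtree.\<close>

lemma bij_betw_sub_lists:
  assumes "ts \<noteq> []"
  shows "bij_betw (\<lambda>I. map (\<lambda>i. sub i I) [0..<length ts]) (Pow (leaf_set (Node ts)))
    (listset (map (\<lambda>i. Pow (leaf_set (ts ! i))) [0..<length ts]))"
proof (rule bij_betw_byWitness[where f' = "\<lambda>Is. {i # p |i p. i < length ts \<and> p \<in> Is ! i}"])
  let ?L = "listset (map (\<lambda>i. Pow (leaf_set (ts ! i))) [0..<length ts])"
  let ?f = "\<lambda>I. map (\<lambda>i. sub i I) [0..<length ts]"
  let ?g = "\<lambda>Is. {i # p |i p. i < length ts \<and> p \<in> Is ! i}"
  have L: "Is \<in> ?L \<longleftrightarrow> length Is = length ts \<and> (\<forall>i<length ts. Is ! i \<subseteq> leaf_set (ts ! i))" for Is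
    by (auto simp: mem_listset_iff list_all2_conv_all_nth subset_iff)
  show "\<forall>I\<in>Pow (leaf_set (Node ts)). ?g (?f I) = I"
  proof (intro ballI set_eqI)
    fix I p assume "I \<in> Pow (leaf_set (Node ts))"
    then have "p \<in> I \<Longrightarrow> p \<in> leaf_set (Node ts)" by auto
    then show "p \<in> ?g (?f I) \<longleftrightarrow> p \<in> I" using assms by (cases p) auto
  qed
  show "\<forall>Is\<in>?L. ?f (?g Is) = Is"
    by (auto simp: L sub_def intro!: nth_equalityI)
  show "?f ` Pow (leaf_set (Node ts)) \<subseteq> ?L"
    by (auto simp: L subset_iff)
  show "?g ` ?L \<subseteq> Pow (leaf_set (Node ts))"
    by (auto simp: L subset_iff)
qed

text \<open>Compatibility with grafting gives a product of sums over the components of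
  \<open>I\<close>. It becomes one sum over \<open>I\<close>, since restriction and complement are
  both computed subtree by subtree.\<close>

lemma coadd_tree_eq_sum:
  assumes "reduced t"
  shows "(coadd_tree t :: 'k::field alg2) =
    (\<Sum>I\<in>Pow (leaf_set t). basis (restriction t I, restriction t (leaf_set t - I)))"
  using assms
proof (induction t)
  case (Node ts)
  show ?case
  proof (cases "ts = []")
    \<comment> \<open>\<open>I = {}\<close> contributes the summand with the leaf on the right,
      \<open>I = {[]}\<close> the one with the leaf on the left.\<close>
    case True
    have "restriction (Node []) {} = None" "restriction (Node []) {[]} = Some leaf"
      by (simp_all add: restriction_def restrict_tree.simps leaf_def)
    moreover have "Pow {[]} = {{}, {[] :: nat list}}" by auto
    ultimately show ?thesis
      unfolding True leaf_set_Node_Nil by (simp add: tensor_basis add.commute)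
  next
    case False
    let ?ns = "[0..<length ts]"
    let ?A = "\<lambda>i. Pow (leaf_set (ts ! i))"
    let ?F = "\<lambda>i I. (restriction (ts ! i) I, restriction (ts ! i) (leaf_set (ts ! i) - I))"
    let ?G = "\<lambda>ps. basis (graft' (map fst ps), graft' (map snd ps)) :: 'k alg2"
    have "map coadd_tree ts = map (\<lambda>i. coadd_tree (ts ! i) :: 'k alg2) ?ns"
      by (rule nth_equalityI) simp_all
    also have "\<dots> = map (\<lambda>i. \<Sum>I\<in>?A i. basis (?F i I)) ?ns"
      using Node by simp
    finally have "coadd_tree (Node ts) = multilin ?G (map (\<lambda>i. \<Sum>I\<in>?A i. basis (?F i I)) ?ns)"
      using False by (simp add: alg2_prod_def tensor_basis)
    also have "\<dots> = (\<Sum>Is\<in>listset (map ?A ?ns). ?G (map2 ?F ?ns Is))"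
      by (rule multilin_sum_basis) (simp add: finite_leaf_set)
    also have "\<dots> = (\<Sum>I\<in>Pow (leaf_set (Node ts)). ?G (map2 ?F ?ns (map (\<lambda>i. sub i I) ?ns)))"
      by (rule sum.reindex_bij_betw[OF bij_betw_sub_lists[OF False], symmetric])
    also have "\<dots> = (\<Sum>I\<in>Pow (leaf_set (Node ts)).
        basis (restriction (Node ts) I, restriction (Node ts) (leaf_set (Node ts) - I)))"
    proof (rule sum.cong)
      fix I assume "I \<in> Pow (leaf_set (Node ts))"
      then have I: "I \<subseteq> leaf_set (Node ts)" "leaf_set (Node ts) - I \<subseteq> leaf_set (Node ts)" by auto
      have diff: "sub i (leaf_set (Node ts) - I) = leaf_set (ts ! i) - sub i I" if "i < length ts" for i
        using that by auto
      have "map2 ?F ?ns (map (\<lambda>i. sub i I) ?ns) = map (\<lambda>i. ?F i (sub i I)) ?ns"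
        by (rule nth_equalityI) simp_all
      moreover have "map fst (map (\<lambda>i. ?F i (sub i I)) ?ns) = map (\<lambda>i. restriction (ts ! i) (sub i I)) ?ns"
        by simp
      moreover have "map snd (map (\<lambda>i. ?F i (sub i I)) ?ns) =
          map (\<lambda>i. restriction (ts ! i) (sub i (leaf_set (Node ts) - I))) ?ns"
        by (simp add: diff)
      ultimately show "?G (map2 ?F ?ns (map (\<lambda>i. sub i I) ?ns)) =
          basis (restriction (Node ts) I, restriction (Node ts) (leaf_set (Node ts) - I))"
        using restriction_Node[OF Node.prems False I(1)] restriction_Node[OF Node.prems False I(2)]
        by metis
    qed simp
    finally show ?thesis .
  qed
qed

lemma splits_None: "splits V W None = (if V = None \<and> W = None then {{}} else {})"
  by (auto simp: splits_def leaves'_def restr_def)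

lemma splits_Some: "splits V W (Some T) = {I. I \<subseteq> leaf_set (Rep_prt T) \<and>
    restriction (Rep_prt T) I = V \<and> restriction (Rep_prt T) (leaf_set (Rep_prt T) - I) = W}"
  by (auto simp: splits_def leaves'_def restr_eq)

text \<open>Each summand of the expansion is one basis element, so the coefficient counts the sets
  \<open>I\<close> with the prescribed pair of restrictions.\<close>

lemma coeff2_coadd_basis: "coeff2 V W (coadd_basis T) = of_nat (card (splits V W T))"
proof (cases T)
  case None
  then show ?thesis
    by (auto simp: coadd_basis_def coeff2_def basis_def lookup_single splits_None when_def)
next
  case (Some U)
  let ?t = "Rep_prt U"
  let ?P = "\<lambda>I. restriction ?t I = V \<and> restriction ?t (leaf_set ?t - I) = W"
  have "coeff2 V W (coadd_basis T) = (\<Sum>I\<in>Pow (leaf_set ?t). if ?P I then 1 else 0)"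
    using Rep_prt[of U] unfolding coeff2_def coadd_basis_def Some
    by (simp add: coadd_tree_eq_sum lookup_sum basis_def lookup_single when_def)
  also have "\<dots> = of_nat (card {I \<in> Pow (leaf_set ?t). ?P I})"
    by (subst sum.inter_filter[symmetric]) (simp_all add: finite_leaf_set)
  also have "{I \<in> Pow (leaf_set ?t). ?P I} = splits V W T" by (auto simp: Some splits_Some)
  finally show ?thesis .
qed

section \<open>Finiteness of the shuffle product\<close>

lemma card_leaf_set_Node:
  assumes "ts \<noteq> []"
  shows "card (leaf_set (Node ts)) = (\<Sum>i<length ts. card (leaf_set (ts ! i)))"
proof -
  have "sub i (leaf_set (Node ts)) = leaf_set (ts ! i)" if "i < length ts" for i
    using that by auto
  then show ?thesis using card_eq_sum_card_sub[OF order_refl assms] by simp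
qed

lemma card_leaf_set_pos: "0 < card (leaf_set t)"
proof (induction t)
  case (Node ts)
  show ?case
  proof (cases "ts = []")
    case False
    then have "card (leaf_set (ts ! 0)) \<le> (\<Sum>i<length ts. card (leaf_set (ts ! i)))"
      by (intro member_le_sum) auto
    then show ?thesis using False Node[of "ts ! 0"] by (simp add: card_leaf_set_Node)
  qed (simp add: leaf_set_Node_Nil)
qed

text \<open>An inner vertex of a reduced tree has at least two children, each carrying a leaf. So
  every subtree has fewer leaves than the whole tree, and the number of children is bounded by the
  number of leaves.\<close>

lemma finite_reduced_trees: "finite {t. reduced t \<and> card (leaf_set t) \<le> n}"
proof (induction n)
  case 0
  have "{t. reduced t \<and> card (leaf_set t) \<le> 0} = {}"
    using card_leaf_set_pos by (metis (no_types, lifting) empty_Collect_eq not_less)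
  then show ?case by (simp only: finite.emptyI)
next
  case (Suc n)
  let ?S = "{t. reduced t \<and> card (leaf_set t) \<le> n}"
  have "{t. reduced t \<and> card (leaf_set t) \<le> Suc n} \<subseteq>
      Node ` {ts. set ts \<subseteq> ?S \<and> length ts \<le> Suc n}"
  proof
    fix t assume t: "t \<in> {t. reduced t \<and> card (leaf_set t) \<le> Suc n}"
    obtain ts where ts: "t = Node ts" by (cases t)
    have "set ts \<subseteq> ?S \<and> length ts \<le> Suc n"
    proof (cases "ts = []")
      case False
      then have len: "2 \<le> length ts" using t ts by (cases ts rule: list.exhaust) (auto simp: Suc_le_eq)
      have sum: "(\<Sum>i<length ts. card (leaf_set (ts ! i))) \<le> Suc n"
        using t ts card_leaf_set_Node[OF False] by simp
      have "card (leaf_set (ts ! i)) \<le> n" if i: "i < length ts" for i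
      proof -
        \<comment> \<open>Another child \<open>j\<close> has at least one leaf, which leaves at most
          \<open>n\<close> for child \<open>i\<close>.\<close>
        obtain j where j: "j < length ts" "j \<noteq> i" using len by (metis One_nat_def Suc_1 Suc_le_lessD
              less_2_cases_iff order_less_le_trans zero_neq_one)
        have "card (leaf_set (ts ! i)) + card (leaf_set (ts ! j)) =
            (\<Sum>k\<in>{i, j}. card (leaf_set (ts ! k)))" using j by simp
        also have "\<dots> \<le> (\<Sum>k<length ts. card (leaf_set (ts ! k)))"
          by (rule sum_mono2) (use i j in auto)
        finally show ?thesis using sum card_leaf_set_pos[of "ts ! j"] by simp
      qed
      then have "set ts \<subseteq> ?S" using t ts by (auto simp: in_set_conv_nth)
      moreover have "(\<Sum>i<length ts. 1) \<le> (\<Sum>i<length ts. card (leaf_set (ts ! i)))"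
        by (rule sum_mono) (simp add: card_leaf_set_pos Suc_le_eq)
      ultimately show ?thesis using sum by simp
    qed simp
    then show "t \<in> Node ` {ts. set ts \<subseteq> ?S \<and> length ts \<le> Suc n}" using ts by blast
  qed
  then show ?case by (rule finite_subset) (intro finite_imageI finite_lists_length_le Suc.IH)
qed

lemma card_leaves'_restriction:
  assumes "reduced t" "I \<subseteq> leaf_set t"
  shows "card (leaves' (restriction t I)) = card I"
proof (cases "restrict_tree t I")
  case None
  then have "I = {}" using restrict_tree_correct[OF assms] by auto
  then show ?thesis using None by (simp add: restriction_def leaves'_def)
next
  case (Some u)
  then show ?thesis
    using restrict_tree_reduced[OF assms Some] by (simp add: restriction_def leaves'_def Abs_prt_inverse)
qed

text \<open>Makes the \<open>Sum_any\<close> in \<open>shuffle\<close> a genuine sum. Restriction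
  keeps the number of selected leaves, so \<open>T\<close> has as many leaves as \<open>V\<close>
  and \<open>W\<close> together, and only finitely many reduced trees qualify.\<close>

lemma finite_splits_support: "finite {T. splits V W T \<noteq> {}}"
proof -
  let ?n = "card (leaves' V) + card (leaves' W)"
  have "card (leaf_set (Rep_prt T)) \<le> ?n" if "splits V W (Some T) \<noteq> {}" for T
  proof -
    let ?L = "leaf_set (Rep_prt T)"
    have red: "reduced (Rep_prt T)" using Rep_prt[of T] by simp
    from that obtain I where I: "I \<subseteq> ?L" "restriction (Rep_prt T) I = V" "restriction (Rep_prt T) (?L - I) = W"
      by (auto simp: splits_Some)
    have "card ?L = card I + card (?L - I)"
      using I(1) finite_leaf_set by (metis card_Diff_subset card_mono finite_subset le_add_diff_inverse)
    then show ?thesis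
      using card_leaves'_restriction[OF red I(1)] card_leaves'_restriction[OF red, of "?L - I"]
      unfolding I(2,3) by simp
  qed
  then have "{T. splits V W T \<noteq> {}} \<subseteq>
      insert None (Some ` Abs_prt ` {t. reduced t \<and> card (leaf_set t) \<le> ?n})"
  proof (intro subsetI)
    fix T assume T: "T \<in> {T. splits V W T \<noteq> {}}"
    show "T \<in> insert None (Some ` Abs_prt ` {t. reduced t \<and> card (leaf_set t) \<le> ?n})"
    proof (cases T)
      case (Some U)
      have "Rep_prt U \<in> {t. reduced t \<and> card (leaf_set t) \<le> ?n}"
        using T Some Rep_prt[of U] \<open>\<And>T. splits V W (Some T) \<noteq> {} \<Longrightarrow> _\<close> by auto
      then have "U \<in> Abs_prt ` {t. reduced t \<and> card (leaf_set t) \<le> ?n}"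
        by (rule image_eqI[rotated]) (simp add: Rep_prt_inverse)
      then show ?thesis unfolding Some by (intro insertI2 imageI)
    qed simp
  qed
  then show ?thesis by (rule finite_subset) (simp add: finite_reduced_trees)
qed

lemma coeff_shuffle: "coeff T (shuffle V W :: 'k::field alg) = of_nat (card (splits V W T))"
proof -
  let ?S = "{T. splits V W T \<noteq> {}}"
  \<comment> \<open>\<open>?S\<close> may exceed the support of the summands, since a positive count
    can vanish in the field.\<close>
  have "shuffle V W = (\<Sum>T\<in>?S. scale (of_nat (card (splits V W T))) (basis T) :: 'k alg)"
    unfolding shuffle_def
    by (rule Sum_any.expand_superset[OF finite_splits_support]) (auto simp: scale_basis)
  then show ?thesis
    by (auto simp: coeff_def lookup_sum basis_def lookup_single when_def finite_splits_support
        if_distrib[of "\<lambda>x. _ * x"] cong: if_cong)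
qed

theorem proposition4p3:
  fixes f :: "'k::field alg" and V W :: "prt option"
  shows "coeff2 V W (Delta f) = Sum_any (\<lambda>T. coeff T f * coeff T (shuffle V W))"
proof -
  have "Delta f = linext coadd_basis f"
    using is_coaddition_unique[OF is_coaddition_Delta] by metis
  then have "coeff2 V W (Delta f) =
      (\<Sum>T\<in>Poly_Mapping.keys f. coeff T f * coeff2 V W (coadd_basis T))"
    by (simp add: linext_def coeff_def coeff2_def lookup_sum)
  also have "\<dots> = (\<Sum>T\<in>Poly_Mapping.keys f. coeff T f * coeff T (shuffle V W))"
    by (simp add: coeff2_coadd_basis coeff_shuffle)
  \<comment> \<open>Outside the support of \<open>f\<close> the factor \<open>coeff T f\<close> is
    zero.\<close>
  also have "\<dots> = Sum_any (\<lambda>T. coeff T f * coeff T (shuffle V W))"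
    by (rule Sum_any.expand_superset[symmetric]) (auto simp: coeff_def in_keys_iff)
  finally show ?thesis .
qed

end
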